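(* Let $X$ be a finite set with $|X|=d\ge 2$, let $\mathfrak M=\mathfrak M(X)$ be the associated Mother group, and put $$\alpha=\frac{\log d}{\log\frac{d^2}{d-1}}<1 .$$ Then for every $\varepsilon>0$ the return profile $\rho_{\mathfrak M}$ and the isoperimetric profile $I_{\mathfrak M}$ of $\mathfrak M$ satisfy $$\rho_{\mathfrak M}(n)\succcurlyeq\exp\left(-n^{\alpha+\varepsilon}\right)\qquad\text{and}\qquad I_{\mathfrak M}(n)\preccurlyeq\exp\left(n^{\frac{2\alpha}{1-\alpha}+\varepsilon}\right).$$
   Context: Mother group: let $X$ be a finite set with a distinguished element $o\in X$ and put $\overline X=X\setminus\{o\}$. Let $\mathfrak W(X)$ be the group of automorphisms of the rooted tree with vertex set $X^*$ (finite words over $X$, root the empty word, edges joining $w$ to $wx$ for $w\in X^*$, $x\in X$), with the product $\alpha\beta$ meaning first $\alpha$, then $\beta$. Let $A=\mathrm{Sym}(X)$ and let $B=A\wr\mathrm{Sym}(\overline X)=A^{\overline X}\rtimes\mathrm{Sym}(\overline X)$ be the permutational wreath product, with multiplication $(\alpha_x)_x\sigma\cdot(\beta_x)_x\tau=(\alpha_x\beta_{\sigma(x)})_x\,\sigma\tau$ (products of permutations read left to right). Embed $A$ in $\mathfrak W(X)$ by $a(xw)=a(x)w$ for $x\in X$, $w\in X^*$. Embed $B$ in $\mathfrak W(X)$ by letting $b=(b_x)_{x\in\overline X}\,\sigma$ (with $b_x\in A$, $\sigma\in\mathrm{Sym}(\overline X)$) act recursively as $b(ow)=o\,b(w)$ and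 $b(xw)=\sigma(x)\,b_x(w)$ for $x\in\overline X$, $w\in X^*$. The Mother group $\mathfrak M(X)=\langle A,B\rangle\subset\mathfrak W(X)$ is the subgroup generated by the finite groups $A$ and $B$; it is finitely generated. Order on functions: for nonnegative functions on $\mathbb R_+$, $f_1\preccurlyeq f_2$ means that there are constants $a,C>0$ with $f_1(t)\le C f_2(at)$ for all $t$; $f_2\succcurlyeq f_1$ means $f_1\preccurlyeq f_2$; $f_1\sim f_2$ (equivalent) means $f_1\preccurlyeq f_2$ and $f_2\preccurlyeq f_1$. A sequence $f(n)$, $n\ge 0$, is viewed as the function $t\mapsto f(\lfloor t\rfloor)$ on $\mathbb R_+$, while explicit expressions such as $\exp(-n^{\beta})$ stand for the corresponding functions of a real variable. Return profile: for a symmetric probability measure $\mu$ on a countable group $G$, $\rho_\mu(n)=\mu^{2n}(e)$, where $\mu^{k}$ is the $k$-fold convolution power and $e$ the identity. For a finitely generated group $G$ the return profiles of all symmetric finitely supported probability measures whose support generates $G$ are equivalent, and $\rho_G$ denotes this equivalence class (the relation $\succcurlyeq$ is understood for any representative). Isoperimetric profile: for a graph $\Gamma$, $I_\Gamma(n)=\min\{|V| : |\partial V|/|V|\le 1/n\}$, the minimum being over finite nonempty vertex subsets $V$ of $\Gamma$, where $\partial V\subset V$ is the boundary of $V$ (the vertices of $V$ having a neighbour outside $V$); for $n=0$ the condition is void, so $I_\Gamma(0)=1$. For a finitely generated group $G$ the isoperimetric profiles of the Cayley graphs with respect to all finite generating sets are equivalent, and $I_G$ denotes this equivalence class. *)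

theory Defs
  imports "HOL-Algebra.Generated_Groups" "HOL-Combinatorics.Permutations" "HOL-Probability.Probability"
begin

section \<open>The automorphism group of the rooted tree\<close>

text \<open>The alphabet \<open>X\<close> is the finite type \<open>'a\<close>, so the vertex set \<open>X\<^sup>*\<close> of the tree
  is the type \<open>'a list\<close>.\<close>

definition tree_adj :: "'a list \<Rightarrow> 'a list \<Rightarrow> bool" where
  "tree_adj u v \<longleftrightarrow> (\<exists>x. v = u @ [x] \<or> u = v @ [x])"

definition tree_aut :: "('a list \<Rightarrow> 'a list) \<Rightarrow> bool" where
  "tree_aut f \<longleftrightarrow> bij f \<and> f [] = [] \<and> (\<forall>u v. tree_adj (f u) (f v) \<longleftrightarrow> tree_adj u v)"

text \<open>Products are read from left to right: \<open>f \<otimes> g\<close> means first \<open>f\<close>, then \<open>g\<close>.\<close>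

definition tree_aut_group :: "('a list \<Rightarrow> 'a list) monoid" where
  "tree_aut_group = \<lparr>carrier = {f. tree_aut f}, monoid.mult = (\<lambda>f g. g \<circ> f), one = id\<rparr>"

section \<open>The Mother group\<close>

fun rooted :: "('a \<Rightarrow> 'a) \<Rightarrow> 'a list \<Rightarrow> 'a list" where
  "rooted a [] = []"
| "rooted a (x # w) = a x # w"

text \<open>The permutational wreath product of \<open>Sym(X)\<close> and \<open>Sym(X - {z})\<close>, where \<open>z\<close> is the
  distinguished element of \<open>X\<close>.\<close>

definition wreath :: "'a \<Rightarrow> (('a \<Rightarrow> 'a \<Rightarrow> 'a) \<times> ('a \<Rightarrow> 'a)) monoid" where
  "wreath z =
    \<lparr>carrier = ((- {z}) \<rightarrow>\<^sub>E {a. a permutes UNIV}) \<times> {\<sigma>. \<sigma> permutes (- {z})},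
     monoid.mult = (\<lambda>(\<alpha>, \<sigma>) (\<beta>, \<tau>). (\<lambda>x\<in>- {z}. \<beta> (\<sigma> x) \<circ> \<alpha> x, \<tau> \<circ> \<sigma>)),
     one = (\<lambda>x\<in>- {z}. id, id)\<rparr>"

fun directed :: "'a \<Rightarrow> ('a \<Rightarrow> 'a \<Rightarrow> 'a) \<times> ('a \<Rightarrow> 'a) \<Rightarrow> 'a list \<Rightarrow> 'a list" where
  "directed z (b, \<sigma>) [] = []"
| "directed z (b, \<sigma>) (x # w) =
    (if x = z then z # directed z (b, \<sigma>) w else \<sigma> x # rooted (b x) w)"

definition mother_gens :: "'a \<Rightarrow> ('a list \<Rightarrow> 'a list) set" where
  "mother_gens z = rooted ` {a. a permutes UNIV} \<union> directed z ` carrier (wreath z)"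

definition mother_group :: "'a \<Rightarrow> ('a list \<Rightarrow> 'a list) monoid" where
  "mother_group z = tree_aut_group \<lparr>carrier := generate tree_aut_group (mother_gens z)\<rparr>"

lemma tree_aut_id: "tree_aut id" by (simp add: tree_aut_def)

lemma tree_aut_comp: "tree_aut f \<Longrightarrow> tree_aut g \<Longrightarrow> tree_aut (g \<circ> f)"
  by (auto simp: tree_aut_def intro: bij_comp)

lemma tree_aut_inv:
  assumes "tree_aut f" shows "tree_aut (inv_into UNIV f)"
proof -
  have b: "bij f" and n: "f [] = []" using assms by (auto simp: tree_aut_def)
  have "inv_into UNIV f [] = []" using b n by (metis bij_inv_eq_iff)
  moreover have "tree_adj (inv_into UNIV f u) (inv_into UNIV f v) = tree_adj u v" for u v
    using assms b by (metis tree_aut_def bij_inv_eq_iff)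
  ultimately show ?thesis using b by (simp add: tree_aut_def bij_imp_bij_inv)
qed

lemma group_tree_aut_group: "group (tree_aut_group :: ('a list \<Rightarrow> 'a list) monoid)"
proof (rule groupI)
  fix f :: "'a list \<Rightarrow> 'a list" assume "f \<in> carrier tree_aut_group"
  then have f: "tree_aut f" by (simp add: tree_aut_group_def)
  then have "f \<circ> inv_into UNIV f = id" by (metis tree_aut_def bij_is_surj surj_iff)
  then show "\<exists>g\<in>carrier tree_aut_group. g \<otimes>\<^bsub>tree_aut_group\<^esub> f = \<one>\<^bsub>tree_aut_group\<^esub>"
    using tree_aut_inv[OF f] by (auto simp: tree_aut_group_def)
qed (auto simp: tree_aut_group_def tree_aut_id tree_aut_comp comp_assoc)

lemma rooted_comp: "rooted (b \<circ> a) w = rooted b (rooted a w)" by (cases w) auto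
lemma rooted_id: "rooted id w = w" by (cases w) auto

lemma tree_autI:
  assumes inv: "\<And>w. g (f w) = w" "\<And>w. f (g w) = w" and "f [] = []"
   and step: "\<And>w x. \<exists>y. f (w @ [x]) = f w @ [y]" "\<And>w x. \<exists>y. g (w @ [x]) = g w @ [y]"
  shows "tree_aut f"
proof -
  have "bij f" using inv by (metis bijI')
  moreover have "tree_adj u v \<Longrightarrow> tree_adj (f u) (f v)" for u v
    using step(1) unfolding tree_adj_def by metis
  moreover have "tree_adj u v \<Longrightarrow> tree_adj (g u) (g v)" for u v
    using step(2) unfolding tree_adj_def by metis
  ultimately show ?thesis using inv assms(3) unfolding tree_aut_def by metis
qed

lemma rooted_step: "\<exists>y. rooted a (w @ [x]) = rooted a w @ [y]" by (cases w) auto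

lemma tree_aut_rooted: "a permutes UNIV \<Longrightarrow> tree_aut (rooted a)"
  by (rule tree_autI[where g = "rooted (inv_into UNIV a)"])
     (auto simp: rooted_comp[symmetric] permutes_inv_o rooted_id rooted_step)

lemma directed_Nil: "directed z p [] = []" by (cases p) simp

lemma directed_step: "\<exists>y. directed z p (w @ [x]) = directed z p w @ [y]"
  by (cases p, induction w) (auto simp: rooted_step)

lemma directed_mult:
  assumes "p \<in> carrier (wreath z)" "q \<in> carrier (wreath z)"
  shows "directed z (p \<otimes>\<^bsub>wreath z\<^esub> q) w = directed z q (directed z p w)"
proof (induction w)
  case Nil show ?case by (cases p, cases q) (simp add: wreath_def)
next
  case (Cons x w)
  obtain a s b t where pq: "p = (a,s)" "q = (b,t)" by (cases p, cases q)
  have "s permutes (- {z})" using assms pq by (simp add: wreath_def)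
  then have "x \<noteq> z \<Longrightarrow> s x \<noteq> z" by (metis ComplD ComplI insertI1 permutes_in_image singletonD)
  then show ?case using Cons pq by (auto simp: wreath_def rooted_comp[unfolded comp_def] comp_def)
qed

lemma directed_one: "directed z (\<one>\<^bsub>wreath z\<^esub>) w = w"
  by (induction w) (auto simp: wreath_def rooted_id)

lemma tree_aut_directed:
  assumes "p \<in> carrier (wreath z)" shows "tree_aut (directed z p)"
proof -
  obtain a s where p: "p = (a,s)" by (cases p)
  have s: "s permutes (- {z})" and a: "\<And>x. x \<noteq> z \<Longrightarrow> a x permutes UNIV" and ae: "a \<in> extensional (- {z})"
    using assms p by (auto simp: wreath_def PiE_def)
  have si: "inv_into UNIV s x \<noteq> z" if "x \<noteq> z" for x
    using that s by (metis ComplD ComplI permutes_in_image permutes_inv singleton_iff)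
  have sz: "s x \<noteq> z" if "x \<noteq> z" for x
    using that s by (metis ComplD ComplI permutes_in_image singleton_iff)
  define q where "q = ((\<lambda>x\<in>- {z}. inv_into UNIV (a (inv_into UNIV s x))), inv_into UNIV s)"
  have q: "q \<in> carrier (wreath z)"
    using s a si by (auto simp: q_def wreath_def permutes_inv)
  have pq: "p \<otimes>\<^bsub>wreath z\<^esub> q = \<one>\<^bsub>wreath z\<^esub>" 
    using s sz permutes_inverses(2)[OF a]
    by (auto simp: p q_def wreath_def permutes_inv_o permutes_inverses fun_eq_iff)
  have qp: "q \<otimes>\<^bsub>wreath z\<^esub> p = \<one>\<^bsub>wreath z\<^esub>" 
    using s si permutes_inverses(1)[OF a]
    by (auto simp: p q_def wreath_def permutes_inv_o permutes_inverses fun_eq_iff)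
  show ?thesis
    by (rule tree_autI[where g = "directed z q"])
       (auto simp: directed_mult[OF assms q, symmetric] directed_mult[OF q assms, symmetric] pq qp directed_one directed_step directed_Nil)
qed

lemma directed_hom: "directed z \<in> hom (wreath z) tree_aut_group"
  by (rule homI) (auto simp: tree_aut_group_def tree_aut_directed directed_mult)

lemma mother_gens_subset: "mother_gens z \<subseteq> carrier tree_aut_group"
  by (auto simp: mother_gens_def tree_aut_group_def tree_aut_rooted tree_aut_directed)

lemma group_mother_group: "group (mother_group z)"
  unfolding mother_group_def
  by (intro group.subgroup_imp_group group.generate_is_subgroup group_tree_aut_group mother_gens_subset)

lemma finite_mother_gens: "finite (mother_gens (z :: 'a::finite))"
  by (auto simp: mother_gens_def wreath_def finite_permutations intro!: finite_PiE finite_cartesian_product)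

section \<open>Comparison of functions on the nonnegative half-line\<close>

text \<open>Values are taken in \<^typ>\<open>ennreal\<close> because the isoperimetric profile of a nonamenable
  group takes the value \<open>\<infinity>\<close>.\<close>

definition fun_preceq :: "(real \<Rightarrow> ennreal) \<Rightarrow> (real \<Rightarrow> ennreal) \<Rightarrow> bool" (infix \<open>\<preccurlyeq>\<close> 50) where
  "f \<preccurlyeq> g \<longleftrightarrow> (\<exists>a C::real. 0 < a \<and> 0 < C \<and> (\<forall>t\<ge>0. f t \<le> ennreal C * g (a * t)))"

abbreviation fun_succeq :: "(real \<Rightarrow> ennreal) \<Rightarrow> (real \<Rightarrow> ennreal) \<Rightarrow> bool" (infix \<open>\<succcurlyeq>\<close> 50) where
  "g \<succcurlyeq> f \<equiv> f \<preccurlyeq> g"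

definition seq_fun :: "(nat \<Rightarrow> ennreal) \<Rightarrow> real \<Rightarrow> ennreal" where
  "seq_fun f t = f (nat \<lfloor>t\<rfloor>)"

section \<open>Return profile\<close>

primrec conv_power :: "('g, 'm) monoid_scheme \<Rightarrow> 'g pmf \<Rightarrow> nat \<Rightarrow> 'g pmf" where
  "conv_power G \<mu> 0 = return_pmf \<one>\<^bsub>G\<^esub>"
| "conv_power G \<mu> (Suc k) = map_pmf (\<lambda>(g, h). g \<otimes>\<^bsub>G\<^esub> h) (pair_pmf (conv_power G \<mu> k) \<mu>)"

definition return_profile :: "('g, 'm) monoid_scheme \<Rightarrow> 'g pmf \<Rightarrow> nat \<Rightarrow> ennreal" where
  "return_profile G \<mu> n = ennreal (pmf (conv_power G \<mu> (2 * n)) \<one>\<^bsub>G\<^esub>)"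

definition symmetric_generating_measure :: "('g, 'm) monoid_scheme \<Rightarrow> 'g pmf \<Rightarrow> bool" where
  "symmetric_generating_measure G \<mu> \<longleftrightarrow>
     set_pmf \<mu> \<subseteq> carrier G \<and> finite (set_pmf \<mu>) \<and>
     (\<forall>g\<in>carrier G. pmf \<mu> (inv\<^bsub>G\<^esub> g) = pmf \<mu> g) \<and>
     generate G (set_pmf \<mu>) = carrier G"

section \<open>Isoperimetric profile\<close>

text \<open>A graph is given by its vertex set \<open>W\<close> and its adjacency relation.\<close>

definition inner_boundary :: "'v set \<Rightarrow> ('v \<Rightarrow> 'v \<Rightarrow> bool) \<Rightarrow> 'v set \<Rightarrow> 'v set" where
  "inner_boundary W adj V = {v\<in>V. \<exists>w\<in>W - V. adj v w}"

text \<open>The condition \<open>|\<partial>V| / |V| \<le> 1 / n\<close> is cleared of denominators, which makes it void for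
  \<open>n = 0\<close>. The infimum is \<open>\<infinity>\<close> if no set \<open>V\<close> is admissible, and a minimum otherwise.\<close>

definition isoperimetric_profile :: "'v set \<Rightarrow> ('v \<Rightarrow> 'v \<Rightarrow> bool) \<Rightarrow> nat \<Rightarrow> ennreal" where
  "isoperimetric_profile W adj n =
     (INF V\<in>{V. V \<subseteq> W \<and> finite V \<and> V \<noteq> {} \<and> n * card (inner_boundary W adj V) \<le> card V}.
        of_nat (card V))"

definition cayley_adj :: "('g, 'm) monoid_scheme \<Rightarrow> 'g set \<Rightarrow> 'g \<Rightarrow> 'g \<Rightarrow> bool" where
  "cayley_adj G S g h \<longleftrightarrow> (\<exists>s\<in>S. h = g \<otimes>\<^bsub>G\<^esub> s \<or> g = h \<otimes>\<^bsub>G\<^esub> s)"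

definition finite_generating_set :: "('g, 'm) monoid_scheme \<Rightarrow> 'g set \<Rightarrow> bool" where
  "finite_generating_set G S \<longleftrightarrow> finite S \<and> S \<subseteq> carrier G \<and> generate G S = carrier G"

lemma mother_gens_generate: "finite_generating_set (mother_group z) (mother_gens (z :: 'a::finite))"
proof -
  interpret group "tree_aut_group :: ('a list \<Rightarrow> 'a list) monoid" by (rule group_tree_aut_group)
  have "mother_gens z \<subseteq> generate tree_aut_group (mother_gens z)" by (auto intro: generate.incl)
  then show ?thesis
    unfolding finite_generating_set_def mother_group_def
    using generate_consistent[OF _ generate_is_subgroup[OF mother_gens_subset], of "mother_gens z" z]
    by (simp add: finite_mother_gens)
qed

abbreviation cayley_isoperimetric_profile ::
    "('g, 'm) monoid_scheme \<Rightarrow> 'g set \<Rightarrow> nat \<Rightarrow> ennreal" where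
  "cayley_isoperimetric_profile G S \<equiv> isoperimetric_profile (carrier G) (cayley_adj G S)"

end

theory Submission
  imports Defs "HOL-Real_Asymp.Real_Asymp"
begin

text \<open>Both bounds come from finitely supported functions \<open>f\<close> on the Mother group which are nearly
  invariant under the generators and have a support of size at most \<open>exp (C n\<^sup>\<beta>)\<close>, with
  displacement at most \<open>C n\<^bsup>\<beta>-1\<^esup> \<parallel>f\<parallel>\<^sup>2\<close>, where \<open>\<beta> > \<alpha>\<close>.

  They are found by self-similarity. Take the random walk whose steps are products of uniform
  elements of \<open>A\<close>, \<open>B\<close> and \<open>A\<close>. The section at a vertex \<open>x\<close> of a random word over \<open>A\<close> and \<open>B\<close>
  replaces every run of \<open>B\<close>-letters by a run of \<open>B\<close>-letters with probability \<open>1/d\<close> and of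
  \<open>A\<close>-letters otherwise, so it has on average \<open>(d - 1)/d\<^sup>2\<close> times as many changes between the
  two kinds of letters. As there are \<open>d\<close> sections, the expected size \<open>F(n)\<close> of the
  portrait of a word satisfies \<open>F(n) \<le> 1 + d F(n (d - 1)/d\<^sup>2 + 1)\<close>, whence \<open>F(n) \<le> C n\<^sup>\<beta>\<close>. There are
  only exponentially many portraits of a given size, and portrait sizes increase along the
  trajectory, so the walk killed outside the set \<open>V\<close> of elements of portrait size at most
  \<open>2 F(n)\<close> keeps half of its mass up to time \<open>n\<close>. By the pigeonhole principle some
  step multiplies the squared \<open>\<ell>\<^sup>2\<close> norm of its distribution by at least \<open>(4 \<bar>V\<bar>)\<^bsup>-1/n\<^esup>\<close>;
  the distribution before that step is \<open>f\<close>.\<close>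

section \<open>Words and their sections\<close>

datatype 'a letter = Rt "'a \<Rightarrow> 'a" | Dr "('a \<Rightarrow> 'a \<Rightarrow> 'a) \<times> ('a \<Rightarrow> 'a)"

definition letters :: "'a \<Rightarrow> 'a letter set" where
  "letters z = Rt ` {a. a permutes UNIV} \<union> Dr ` carrier (wreath z)"

lemma letters_iff [simp]:
  "Rt a \<in> letters z \<longleftrightarrow> a permutes UNIV"
  "Dr p \<in> letters z \<longleftrightarrow> p \<in> carrier (wreath z)"
  by (auto simp: letters_def)

fun is_Dr :: "'a letter \<Rightarrow> bool" where
  "is_Dr (Rt a) = False"
| "is_Dr (Dr p) = True"

fun act :: "'a \<Rightarrow> 'a letter \<Rightarrow> 'a list \<Rightarrow> 'a list" where
  "act z (Rt a) = rooted a"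
| "act z (Dr p) = directed z p"

text \<open>The first letter acts first, as in the left-to-right products of the group, so appending
  letters is right multiplication.\<close>

fun eval_word :: "'a \<Rightarrow> 'a letter list \<Rightarrow> 'a list \<Rightarrow> 'a list" where
  "eval_word z [] = id"
| "eval_word z (c # w) = eval_word z w \<circ> act z c"

fun position :: "'a \<Rightarrow> 'a \<Rightarrow> 'a letter list \<Rightarrow> 'a" where
  "position z x [] = x"
| "position z x (Rt a # w) = position z (a x) w"
| "position z x (Dr p # w) = (if x = z then position z z w else position z (snd p x) w)"

text \<open>By the recursive formulas for \<open>A\<close> and \<open>B\<close>, a rooted letter
  acts trivially below the first level and leaves no letter in a section. A directed letter survives
  at \<open>z\<close> and leaves the rooted letter \<open>fst p x\<close> at any other vertex. The
  vertex moves along with the prefix read so far.\<close>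

fun section_word :: "'a \<Rightarrow> 'a \<Rightarrow> 'a letter list \<Rightarrow> 'a letter list" where
  "section_word z x [] = []"
| "section_word z x (Rt a # w) = section_word z (a x) w"
| "section_word z x (Dr p # w) =
    (if x = z then Dr p # section_word z z w else Rt (fst p x) # section_word z (snd p x) w)"

abbreviation pattern :: "'a letter list \<Rightarrow> bool list" where
  "pattern \<equiv> map is_Dr"

fun changes :: "bool list \<Rightarrow> nat" where
  "changes (s # t # w) = (if s = t then 0 else 1) + changes (t # w)"
| "changes _ = 0"

lemma changes_le_Cons: "changes w \<le> changes (t # w)"
  by (cases w) auto

lemma changes_append_le: "changes v \<le> changes (v @ w)"
  by (induction v rule: changes.induct) auto

lemma eval_word_append: "eval_word z (v @ w) = eval_word z w \<circ> eval_word z v"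
  by (induction v) auto

lemma eval_word_Nil: "eval_word z w [] = []"
proof (induction w)
  case (Cons c w) then show ?case by (cases c) (auto simp: directed_Nil)
qed auto

lemma eval_word_Cons: "eval_word z w (x # v) = position z x w # eval_word z (section_word z x w) v"
proof (induction w arbitrary: x v)
  case (Cons c w)
  show ?case
  proof (cases c)
    case (Dr p)
    then show ?thesis using Cons by (cases p) auto
  qed (use Cons in auto)
qed auto

lemma section_word_append:
  "section_word z x (v @ w) = section_word z x v @ section_word z (position z x v) w"
proof (induction v arbitrary: x)
  case (Cons c v) then show ?case by (cases c) auto
qed auto

lemma wreath_fst_permutes: "p \<in> carrier (wreath z) \<Longrightarrow> x \<noteq> z \<Longrightarrow> fst p x permutes UNIV"
  unfolding wreath_def by (cases p) (force dest: PiE_mem)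

lemma section_word_letters:
  "set w \<subseteq> letters z \<Longrightarrow> set (section_word z x w) \<subseteq> letters z"
proof (induction w arbitrary: x)
  case (Cons c w)
  then have IH: "set (section_word z y w) \<subseteq> letters z" for y by simp
  show ?case
  proof (cases c)
    case (Dr p)
    then show ?thesis using IH Cons.prems wreath_fst_permutes[of p z x] by simp
  qed (simp add: IH)
qed auto

section \<open>Length and number of changes of a section\<close>

lemma length_section_word: "length (section_word z x w) = length (filter id (pattern w))"
proof (induction w arbitrary: x)
  case (Cons c w) then show ?case by (cases c) auto
qed auto

lemma changes_replicate: "changes (replicate n t) = 0"
proof (induction n)
  case (Suc n) then show ?case by (cases n) auto
qed auto

text \<open>A word with a change contains a rooted letter, which sections drop; this makes the
  portrait recursion terminate.\<close>

lemma length_filter_id_less: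
  assumes "changes s > 0" shows "length (filter id s) < length s"
proof (rule ccontr)
  assume "\<not> ?thesis"
  then have "filter id s = s"
    using length_filter_less[of _ s id] by (metis filter_id_conv)
  then have "\<forall>t\<in>set s. t = True" by (simp add: filter_id_conv)
  then obtain n where "s = replicate n True" using replicate_eqI by metis
  with assms show False by (simp add: changes_replicate)
qed

lemma wreath_snd_neq:
  assumes "p \<in> carrier (wreath z)" "x \<noteq> z" shows "snd p x \<noteq> z"
proof -
  have "snd p permutes (- {z})" using assms(1) by (cases p) (simp add: wreath_def)
  then show ?thesis using assms(2) permutes_in_image[of "snd p" "- {z}" x] by simp
qed

text \<open>Along a run of directed letters the vertex either stays at \<open>z\<close> or stays off
  it, so the run leaves letters of one kind, recorded by \<open>x = z\<close>. A change in the
  section therefore needs a run of rooted letters in between, which costs two changes in the word.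
  In the second clause such a run has already begun and one of the two changes is already paid,
  hence the \<open>+ 1\<close>. In the third clause the section has no letter yet.\<close>

lemma changes_section_word_aux:
  assumes "set w \<subseteq> letters z"
  shows "2 * changes ((x = z) # pattern (section_word z x w)) \<le> changes (True # pattern w)"
    and "2 * changes (t # pattern (section_word z x w)) \<le> changes (False # pattern w) + 1"
    and "2 * changes (pattern (section_word z x w)) \<le> changes (False # pattern w)"
  using assms
proof (induction w arbitrary: x t)
  case (Cons c w)
  {
    case 1
    show ?case
    proof (cases c)
      case (Rt a) then show ?thesis using Cons.IH(2)[where x = "a x" and t = "x = z"] 1 by auto
    next
      case (Dr p)
      then have "x \<noteq> z \<Longrightarrow> snd p x \<noteq> z" using wreath_snd_neq[of p z x] 1 by simp
      then show ?thesis using Dr Cons.IH(1)[where x = x] Cons.IH(1)[where x = "snd p x"] 1 by auto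
    qed
  next
    case 2
    show ?case
    proof (cases c)
      case (Rt a) then show ?thesis using Cons.IH(2)[where x = "a x" and t = t] 2 by auto
    next
      case (Dr p)
      then have "x \<noteq> z \<Longrightarrow> snd p x \<noteq> z" using wreath_snd_neq[of p z x] 2 by simp
      then show ?thesis using Dr Cons.IH(1)[where x = x] Cons.IH(1)[where x = "snd p x"] 2 by auto
    qed
  next
    case 3
    show ?case
    proof (cases c)
      case (Rt a) then show ?thesis using Cons.IH(3)[where x = "a x"] 3 by auto
    next
      case (Dr p)
      then have "x \<noteq> z \<Longrightarrow> snd p x \<noteq> z" using wreath_snd_neq[of p z x] 3 by simp
      then show ?thesis using Dr Cons.IH(1)[where x = x] Cons.IH(1)[where x = "snd p x"] 3 by auto
    qed
  }
qed auto

lemma changes_section_word: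
  assumes "set w \<subseteq> letters z"
  shows "2 * changes (pattern (section_word z x w)) \<le> changes (pattern w)"
proof (cases w)
  case (Cons c v)
  show ?thesis
  proof (cases c)
    case (Rt a) then show ?thesis using Cons assms changes_section_word_aux(3)[of v z] by auto
  next
    case (Dr p)
    then show ?thesis using Cons assms changes_section_word_aux(1)[of w z x] by (auto split: if_splits)
  qed
qed auto

section \<open>Portrait size\<close>

text \<open>Number of nodes of the tree of iterated sections, cut off where all letters are of one
  kind: such a word represents an element of the finite group \<open>A\<close> or
  \<open>B\<close>.\<close>

function portrait_size :: "'a::finite \<Rightarrow> 'a letter list \<Rightarrow> nat" where
  "portrait_size z w = (if changes (pattern w) = 0 then 1
     else 1 + (\<Sum>x\<in>UNIV. portrait_size z (section_word z x w)))"
  by auto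
termination
  by (relation "Wellfounded.measure (length \<circ> snd)")
     (auto simp: length_section_word dest!: length_filter_id_less)

declare portrait_size.simps [simp del]

text \<open>The section of \<open>v @ w\<close> starts with the section of \<open>v\<close>, so the
  portrait of the prefix is a subtree, with the same root, of the portrait of the whole
  word.\<close>

lemma portrait_size_append: "portrait_size z v \<le> portrait_size z (v @ w)"
proof (induction z v arbitrary: w rule: portrait_size.induct)
  case (1 z v)
  show ?case
  proof (cases "changes (pattern v) = 0")
    case True
    then show ?thesis by (subst (1 2) portrait_size.simps) simp
  next
    case False
    then have "changes (pattern (v @ w)) \<noteq> 0"
      using changes_append_le[of "pattern v" "pattern w"] by auto
    with False 1 show ?thesis
      by (subst (1 2) portrait_size.simps) (auto simp: section_word_append intro!: sum_mono)
  qed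
qed

text \<open>Each level lowers a positive number of changes by at least one, and
  \<open>1 + d * q ^ k \<le> q ^ Suc k\<close> for \<open>q = d + 1\<close>. The bound is applied to
  words with few changes.\<close>

lemma portrait_size_le:
  fixes z :: "'a::finite"
  assumes "set w \<subseteq> letters z"
  shows "portrait_size z w \<le> (CARD('a) + 1) ^ changes (pattern w)"
  using assms
proof (induction z w rule: portrait_size.induct)
  case (1 z w)
  define q where "q = CARD('a) + 1"
  show ?case
  proof (cases "changes (pattern w) = 0")
    case True
    then show ?thesis by (simp add: portrait_size.simps[of z w])
  next
    case False
    then obtain k where k: "changes (pattern w) = Suc k" by (cases "changes (pattern w)") auto
    have "portrait_size z (section_word z x w) \<le> q ^ k" for x
    proof -
      have "changes (pattern (section_word z x w)) \<le> k"
        using changes_section_word[OF 1(2), of x] k by simp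
      then have "q ^ changes (pattern (section_word z x w)) \<le> q ^ k"
        by (intro power_increasing) (auto simp: q_def)
      then show ?thesis
        using 1(1)[of x] 1(2) False section_word_letters[OF 1(2), of x] q_def order_trans by blast
    qed
    then have "(\<Sum>x\<in>UNIV. portrait_size z (section_word z x w)) \<le> (\<Sum>x\<in>(UNIV::'a set). q ^ k)"
      by (intro sum_mono) auto
    then have "portrait_size z w \<le> 1 + CARD('a) * q ^ k"
      using False by (simp add: portrait_size.simps[of z w])
    also have "\<dots> \<le> q ^ Suc k"
      using one_le_power[of q k] by (simp add: q_def)
    finally show ?thesis by (simp add: k q_def)
  qed
qed

section \<open>Coding portraits by words over a finite set of symbols\<close>

text \<open>A portrait is written as a word in prefix order: a leaf is an element of
  \<^term>\<open>mother_gens z\<close>, an inner node is the permutation acting at the root.\<close>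

definition alphabet :: "'a::finite list" where
  "alphabet = (SOME xs. set xs = UNIV \<and> distinct xs)"

lemma alphabet: "set (alphabet :: 'a::finite list) = UNIV" "distinct (alphabet :: 'a list)"
  using someI_ex[OF finite_distinct_list[OF finite]] unfolding alphabet_def by auto

lemma length_alphabet: "length (alphabet :: 'a::finite list) = CARD('a)"
  using distinct_card[OF alphabet(2), symmetric] by (metis alphabet(1) distinct_card)

definition branch :: "('a::finite \<Rightarrow> 'a) \<Rightarrow> ('a list \<Rightarrow> 'a list) list \<Rightarrow> 'a list \<Rightarrow> 'a list" where
  "branch \<sigma> fs u = (case u of [] \<Rightarrow> [] | x # v \<Rightarrow> \<sigma> x # the (map_of (zip alphabet fs) x) v)"

text \<open>Prefix notation is decoded from the right: the decoded tail is a stack of trees, from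
  which an inner node takes its \<open>CARD('a)\<close> subtrees.\<close>

fun decode :: "(('a::finite list \<Rightarrow> 'a list) + ('a \<Rightarrow> 'a)) list \<Rightarrow> ('a list \<Rightarrow> 'a list) list" where
  "decode [] = []"
| "decode (Inl g # L) = g # decode L"
| "decode (Inr \<sigma> # L) =
    branch \<sigma> (take CARD('a) (decode L)) # drop CARD('a) (decode L)"

definition symbols :: "'a::finite \<Rightarrow> (('a list \<Rightarrow> 'a list) + ('a \<Rightarrow> 'a)) set" where
  "symbols z = Inl ` mother_gens z \<union> range Inr"

lemma finite_symbols: "finite (symbols z)"
  by (simp add: symbols_def finite_mother_gens)

text \<open>Without changes all letters come from \<open>A\<close> or all come from
  \<open>B\<close>, and both are closed under products. Thus the leaves of portraits carry finitely
  many labels.\<close>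

lemma eval_word_monochromatic:
  assumes "set w \<subseteq> letters z" "changes (pattern w) = 0"
  shows "eval_word z w \<in> mother_gens z"
proof -
  have R: "\<exists>a. a permutes UNIV \<and> eval_word z w = rooted a"
    if "set w \<subseteq> letters z" "\<forall>c\<in>set w. \<not> is_Dr c" for w
    using that
  proof (induction w)
    case Nil
    show ?case using permutes_id rooted_id by (metis eval_word.simps(1) ext id_apply)
  next
    case (Cons c w)
    then obtain a where a: "a permutes UNIV" "eval_word z w = rooted a" by auto
    from Cons obtain b where b: "c = Rt b" "b permutes UNIV"
      by (cases c) (auto simp: letters_def)
    have "eval_word z (c # w) = rooted (a \<circ> b)" using a b by (simp add: fun_eq_iff rooted_comp)
    then show ?case using a b permutes_compose by blast
  qed
  interpret W: group "tree_aut_group :: ('a list \<Rightarrow> 'a list) monoid" by (rule group_tree_aut_group)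
  have D: "\<exists>p. p \<in> carrier (wreath z) \<and> eval_word z w = directed z p"
    if "set w \<subseteq> letters z" "\<forall>c\<in>set w. is_Dr c" for w
    using that
  proof (induction w)
    case Nil
    have "\<one>\<^bsub>wreath z\<^esub> \<in> carrier (wreath z)" by (auto simp: wreath_def permutes_id)
    then show ?case using directed_one by (metis eval_word.simps(1) ext id_apply)
  next
    case (Cons c w)
    then obtain p where p: "p \<in> carrier (wreath z)" "eval_word z w = directed z p" by auto
    from Cons obtain q where q: "c = Dr q" "q \<in> carrier (wreath z)"
      by (cases c) (auto simp: letters_def)
    have "q \<otimes>\<^bsub>wreath z\<^esub> p \<in> carrier (wreath z)"
      using p q wreath_snd_neq[OF q(2)]
      by (auto simp: wreath_def permutes_compose PiE_def Pi_def)
    moreover have "eval_word z (c # w) = directed z (q \<otimes>\<^bsub>wreath z\<^esub> p)"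
      using p q directed_mult[OF q(2) p(1)] by (simp add: fun_eq_iff)
    ultimately show ?case by blast
  qed
  have "changes s = 0 \<Longrightarrow> (\<forall>t\<in>set s. t) \<or> (\<forall>t\<in>set s. \<not> t)" for s
    by (induction s rule: changes.induct) (auto split: if_splits)
  from this[OF assms(2)] show ?thesis
    using R[OF assms(1)] D[OF assms(1)] unfolding mother_gens_def by auto
qed

lemma decode_concat:
  assumes "\<And>x R. x \<in> set xs \<Longrightarrow> decode (L x @ R) = g x # decode R"
  shows "decode (concat (map L xs) @ R') = map g xs @ decode R'"
  using assms by (induction xs) auto

text \<open>The tail \<open>R\<close> is arbitrary so that the codes of the sections can be
  concatenated and consumed one after the other.\<close>

lemma portrait_code:
  fixes z :: "'a::finite"
  assumes "set w \<subseteq> letters z"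
  shows "\<exists>L. length L = portrait_size z w \<and> set L \<subseteq> symbols z \<and>
    (\<forall>R. decode (L @ R) = eval_word z w # decode R)"
  using assms
proof (induction z w rule: portrait_size.induct)
  case (1 z w)
  show ?case
  proof (cases "changes (pattern w) = 0")
    case True
    then show ?thesis using eval_word_monochromatic[OF 1(2)]
      by (intro exI[of _ "[Inl (eval_word z w)]"]) (auto simp: portrait_size.simps[of z w] symbols_def)
  next
    case False
    have "\<exists>L. length L = portrait_size z (section_word z x w) \<and> set L \<subseteq> symbols z \<and>
        (\<forall>R. decode (L @ R) = eval_word z (section_word z x w) # decode R)" for x
      by (rule 1(1)[OF False UNIV_I section_word_letters[OF 1(2)]])
    then obtain L where L: "\<And>x. length (L x) = portrait_size z (section_word z x w)"
        "\<And>x. set (L x) \<subseteq> symbols z"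
        "\<And>x R. decode (L x @ R) = eval_word z (section_word z x w) # decode R"
      by metis
    \<comment> \<open>The root permutation comes first, then the codes of the sections in the order
      in which \<open>branch\<close> reads them.\<close>
    define L' where "L' = Inr (\<lambda>x. position z x w) # concat (map L alphabet)"
    have "decode (L' @ R) = eval_word z w # decode R" for R
    proof -
      have "decode (concat (map L alphabet) @ R) =
          map (\<lambda>x. eval_word z (section_word z x w)) alphabet @ decode R"
        by (rule decode_concat) (rule L(3))
      moreover have "branch (\<lambda>x. position z x w) (map (\<lambda>x. eval_word z (section_word z x w)) alphabet) = eval_word z w"
        by (rule ext) (simp add: branch_def eval_word_Nil eval_word_Cons map_of_zip_map alphabet split: list.split)
      ultimately show ?thesis by (simp add: L'_def length_alphabet)
    qed
    moreover have "length L' = portrait_size z w"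
      using False by (simp add: L'_def length_concat comp_def L(1) portrait_size.simps[of z w]
        sum_list_distinct_conv_sum_set alphabet)
    moreover have "set L' \<subseteq> symbols z" using L(2) by (auto simp: L'_def symbols_def)
    ultimately show ?thesis by blast
  qed
qed

definition small_elements :: "'a::finite \<Rightarrow> nat \<Rightarrow> ('a list \<Rightarrow> 'a list) set" where
  "small_elements z m = eval_word z ` {w. set w \<subseteq> letters z \<and> portrait_size z w \<le> m}"

text \<open>An element is recovered from the code of any of its portraits, so there are at most as
  many elements as codes of length at most \<open>m\<close>.\<close>

lemma small_elements_card:
  fixes z :: "'a::finite"
  shows "finite (small_elements z m)"
    and "card (small_elements z m) \<le> (card (symbols z) + 1) ^ (m + 1)"
proof -
  let ?S = "{L. set L \<subseteq> symbols z \<and> length L \<le> m}"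
  have sub: "small_elements z m \<subseteq> (\<lambda>L. hd (decode L)) ` ?S"
  proof
    fix g assume "g \<in> small_elements z m"
    then obtain w where w: "set w \<subseteq> letters z" "portrait_size z w \<le> m" "g = eval_word z w"
      by (auto simp: small_elements_def)
    obtain L where L: "length L = portrait_size z w" "set L \<subseteq> symbols z"
        "\<forall>R. decode (L @ R) = eval_word z w # decode R"
      using portrait_code[OF w(1)] by blast
    have "g = hd (decode L)" using L(3)[rule_format, of "[]"] w(3) by simp
    moreover have "L \<in> ?S" using L(1,2) w(2) by simp
    ultimately show "g \<in> (\<lambda>L. hd (decode L)) ` ?S" by (rule image_eqI)
  qed
  have fin: "finite ?S" using finite_symbols by (rule finite_lists_length_le)
  then show "finite (small_elements z m)" using sub finite_surj by blast
  have "card (small_elements z m) \<le> card ?S" using sub fin by (rule surj_card_le[rotated])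
  also have "\<dots> = (\<Sum>i\<le>m. card (symbols z) ^ i)" by (rule card_lists_length_le[OF finite_symbols])
  also have "\<dots> \<le> (card (symbols z) + 1) ^ (m + 1)"
  proof -
    have "(\<Sum>i\<le>m. k ^ i) \<le> (k + 1) ^ (m + 1)" for k :: nat
    proof (induction m)
      case (Suc m)
      have "k ^ Suc m \<le> k * (k + 1) ^ Suc m"
        using power_mono[of k "k + 1" m] by (auto intro!: mult_mono trans_le_add1)
      then show ?case using Suc.IH by (simp add: algebra_simps)
    qed auto
    then show ?thesis .
  qed
  finally show "card (small_elements z m) \<le> (card (symbols z) + 1) ^ (m + 1)" .
qed

section \<open>Random words\<close>

definition average :: "'b set \<Rightarrow> ('b \<Rightarrow> real) \<Rightarrow> real" where
  "average S f = sum f S / card S"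

lemma average_mono: "(\<And>x. x \<in> S \<Longrightarrow> f x \<le> g x) \<Longrightarrow> average S f \<le> average S g"
  by (simp add: average_def divide_right_mono sum_mono)

lemma average_const: "finite S \<Longrightarrow> S \<noteq> {} \<Longrightarrow> average S (\<lambda>x. c) = c"
  by (simp add: average_def)

lemma average_affine:
  "finite S \<Longrightarrow> S \<noteq> {} \<Longrightarrow> average S (\<lambda>x. a * f x + b) = a * average S f + b"
  by (simp add: average_def sum.distrib sum_distrib_left[symmetric] add_divide_distrib)

lemma average_add: "average S (\<lambda>x. f x + g x) = average S f + average S g"
  by (simp add: average_def sum.distrib add_divide_distrib)

lemma average_sum: "average S (\<lambda>x. \<Sum>y\<in>T. f x y) = (\<Sum>y\<in>T. average S (\<lambda>x. f x y))"
  unfolding average_def by (subst sum.swap) (simp add: sum_divide_distrib)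

lemma average_swap: "average S (\<lambda>x. average T (f x)) = average T (\<lambda>y. average S (\<lambda>x. f x y))"
  unfolding average_def sum_divide_distrib by (subst sum.swap) (simp add: mult.commute)

text \<open>Equal fibers mean that the map carries the uniform distribution to the uniform
  distribution; the common fiber size cancels.\<close>

lemma average_fibers:
  assumes "finite S" "S \<noteq> {}" "finite T" "\<phi> ` S \<subseteq> T"
    and "\<And>t t'. t \<in> T \<Longrightarrow> t' \<in> T \<Longrightarrow> card {s \<in> S. \<phi> s = t} = card {s \<in> S. \<phi> s = t'}"
  shows "average S (\<lambda>s. g (\<phi> s)) = average T g"
proof -
  obtain s0 where s0: "s0 \<in> S" using assms by auto
  define k where "k = card {s \<in> S. \<phi> s = \<phi> s0}"
  have k: "card {s \<in> S. \<phi> s = t} = k" if "t \<in> T" for t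
    unfolding k_def using assms s0 that by blast
  have *: "(\<Sum>s\<in>S. h (\<phi> s)) = real k * sum h T" for h :: "_ \<Rightarrow> real"
  proof -
    have "(\<Sum>s\<in>S. h (\<phi> s)) = (\<Sum>t\<in>T. \<Sum>s\<in>{s \<in> S. \<phi> s = t}. h (\<phi> s))"
      using assms by (intro sum.group[symmetric]) auto
    also have "\<dots> = (\<Sum>t\<in>T. real k * h t)" by (intro sum.cong) (auto simp: k)
    finally show ?thesis by (simp add: sum_distrib_left)
  qed
  have "real (card S) = real k * real (card T)" using *[of "\<lambda>_. 1"] by simp
  moreover have "card S > 0" using assms by (simp add: card_gt_0_iff)
  ultimately show ?thesis unfolding average_def * by auto
qed

lemma average_Times:
  "average (S \<times> T) f = average S (\<lambda>x. average T (\<lambda>y. f (x, y)))"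
  unfolding average_def by (simp add: sum.cartesian_product' sum_divide_distrib[symmetric] card_cartesian_product mult.commute)

section \<open>Uniform elements of the two finite groups\<close>

abbreviation perms :: "('a \<Rightarrow> 'a) set" where
  "perms \<equiv> {a. a permutes UNIV}"

lemma finite_perms: "finite (perms :: ('a::finite \<Rightarrow> 'a) set)" "(perms :: ('a \<Rightarrow> 'a) set) \<noteq> {}"
  by (auto simp: finite_permutations intro: exI[of _ id] permutes_id)

lemma finite_wreath: "finite (carrier (wreath (z::'a::finite)))" "carrier (wreath z) \<noteq> {}"
proof -
  show "finite (carrier (wreath z))"
    by (auto simp: wreath_def finite_permutations intro!: finite_PiE finite_cartesian_product)
  have "((\<lambda>x\<in>- {z}. id), id) \<in> carrier (wreath z)" by (auto simp: wreath_def permutes_id)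
  then show "carrier (wreath z) \<noteq> {}" by blast
qed

lemma average_perms_apply:
  fixes x :: "'a::finite"
  shows "average perms (\<lambda>a. g (a x)) = average UNIV g"
proof (rule average_fibers)
  fix y y' :: 'a
  \<comment> \<open>Composition with the transposition of \<open>y\<close> and \<open>y'\<close>
    matches the two fibers.\<close>
  let ?t = "Transposition.transpose y y'"
  have t: "?t permutes UNIV" by (rule permutes_swap_id) auto
  have comp: "?t \<circ> a \<in> perms" if "a \<in> perms" for a using that permutes_compose[OF _ t] by simp
  have "bij_betw (\<lambda>a. ?t \<circ> a) {a \<in> perms. a x = y} {a \<in> perms. a x = y'}"
    by (rule bij_betwI[where g = "\<lambda>a. ?t \<circ> a"])
       (use comp in \<open>auto simp: comp_assoc[symmetric]\<close>)
  then show "card {a \<in> perms. a x = y} = card {a \<in> perms. a x = y'}" by (rule bij_betw_same_card)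
qed (use finite_perms in \<open>simp_all\<close>)

text \<open>A uniform element of \<open>B\<close> has independent uniform values
  \<open>fst p x\<close> and \<open>snd p x\<close>: replacing the coordinate at \<open>x\<close>
  and composing with a transposition that fixes \<open>z\<close> carries any fiber onto any
  other.\<close>

lemma average_wreath_apply:
  fixes z :: "'a::finite"
  assumes "x \<noteq> z"
  shows "average (carrier (wreath z)) (\<lambda>p. g (fst p x) (snd p x)) =
    average (- {z}) (\<lambda>y. average perms (\<lambda>a. g a y))"
proof -
  let ?T = "(perms :: ('a \<Rightarrow> 'a) set) \<times> (- {z})"
  have "average (carrier (wreath z)) (\<lambda>p. case_prod g (fst p x, snd p x)) = average ?T (case_prod g)"
  proof (rule average_fibers)
    show "(\<lambda>p. (fst p x, snd p x)) ` carrier (wreath z) \<subseteq> ?T"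
      using assms wreath_snd_neq wreath_fst_permutes by fastforce
  next
    fix t t' assume "t \<in> ?T" "t' \<in> ?T"
    moreover obtain c y c' y' where t: "t = (c, y)" "t' = (c', y')" by (cases t, cases t')
    ultimately have c: "c permutes UNIV" "c' permutes UNIV" and y: "y \<noteq> z" "y' \<noteq> z" by auto
    let ?F = "\<lambda>c y. {p \<in> carrier (wreath z). (fst p x, snd p x) = (c, y)}"
    let ?\<tau> = "Transposition.transpose y y'"
    have \<tau>: "?\<tau> permutes - {z}" using y by (intro permutes_swap_id) auto
    define \<Phi> where "\<Phi> c p = ((fst p)(x := c), ?\<tau> \<circ> snd p)" for c and p :: "('a \<Rightarrow> 'a \<Rightarrow> 'a) \<times> ('a \<Rightarrow> 'a)"
    have car: "\<Phi> c p \<in> carrier (wreath z)" if "c permutes UNIV" "p \<in> carrier (wreath z)" for c p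
      using that assms permutes_compose[OF _ \<tau>, of "snd p"]
      by (cases p) (auto simp: wreath_def \<Phi>_def PiE_def Pi_def extensional_def)
    have "bij_betw (\<Phi> c') (?F c y) (?F c' y')"
    proof (rule bij_betwI[where g = "\<Phi> c"])
      show "\<Phi> c' \<in> ?F c y \<rightarrow> ?F c' y'" using car[OF c(2)] by (auto simp: \<Phi>_def)
      show "\<Phi> c \<in> ?F c' y' \<rightarrow> ?F c y" using car[OF c(1)] by (auto simp: \<Phi>_def)
      show "\<Phi> c (\<Phi> c' p) = p" if "p \<in> ?F c y" for p
        using that by (cases p) (auto simp: \<Phi>_def comp_assoc[symmetric])
      show "\<Phi> c' (\<Phi> c p) = p" if "p \<in> ?F c' y'" for p
        using that by (cases p) (auto simp: \<Phi>_def comp_assoc[symmetric])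
    qed
    then show "card {p \<in> carrier (wreath z). (fst p x, snd p x) = t} =
        card {p \<in> carrier (wreath z). (fst p x, snd p x) = t'}"
      unfolding t by (rule bij_betw_same_card)
  qed (auto simp: finite_wreath finite_perms)
  also have "\<dots> = average perms (\<lambda>a. average (- {z}) (g a))" by (simp add: average_Times)
  also have "\<dots> = average (- {z}) (\<lambda>y. average perms (\<lambda>a. g a y))" by (rule average_swap)
  finally show ?thesis by simp
qed

section \<open>Independent uniform letters with a prescribed pattern\<close>

fun word_mean :: "'a::finite \<Rightarrow> bool list \<Rightarrow> ('a letter list \<Rightarrow> real) \<Rightarrow> real" where
  "word_mean z [] f = f []"
| "word_mean z (False # s) f = average perms (\<lambda>a. word_mean z s (\<lambda>w. f (Rt a # w)))"
| "word_mean z (True # s) f = average (carrier (wreath z)) (\<lambda>p. word_mean z s (\<lambda>w. f (Dr p # w)))"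

text \<open>The mean of \<open>g\<close> over the patterns of the sections at \<open>x\<close> of random words with pattern \<open>s\<close>.\<close>

fun pattern_mean :: "'a::finite \<Rightarrow> 'a \<Rightarrow> bool list \<Rightarrow> (bool list \<Rightarrow> real) \<Rightarrow> real" where
  "pattern_mean z x [] g = g []"
| "pattern_mean z x (False # s) g = average UNIV (\<lambda>y. pattern_mean z y s g)"
| "pattern_mean z x (True # s) g =
    (if x = z then pattern_mean z z s (\<lambda>r. g (True # r))
     else average (- {z}) (\<lambda>y. pattern_mean z y s (\<lambda>r. g (False # r))))"

lemma word_mean_mono:
  assumes "\<And>w. set w \<subseteq> letters z \<Longrightarrow> pattern w = s \<Longrightarrow> f w \<le> g w"
  shows "word_mean z s f \<le> word_mean z s g"
  using assms
proof (induction s arbitrary: f g)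
  case (Cons t s)
  show ?case
  proof (cases t)
    case True
    then have t: "t = True" by simp
    show ?thesis unfolding t word_mean.simps
      by (intro average_mono Cons.IH Cons.prems) (auto simp: t)
  next
    case False
    then have t: "t = False" by simp
    show ?thesis unfolding t word_mean.simps
      by (intro average_mono Cons.IH Cons.prems) (auto simp: t)
  qed
qed auto

lemma word_mean_cong:
  assumes "\<And>w. set w \<subseteq> letters z \<Longrightarrow> pattern w = s \<Longrightarrow> f w = g w"
  shows "word_mean z s f = word_mean z s g"
  by (intro antisym word_mean_mono) (simp_all add: assms)

lemma word_mean_affine: "word_mean z s (\<lambda>w. a * f w + b) = a * word_mean z s f + b"
proof (induction s arbitrary: f)
  case (Cons t s)
  then show ?case by (cases t) (simp_all add: average_affine[OF finite_perms] average_affine[OF finite_wreath])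
qed auto

lemma word_mean_const: "word_mean z s (\<lambda>w. b) = b"
  using word_mean_affine[of z s 0 "\<lambda>_. 0" b] by simp

lemma word_mean_add: "word_mean z s (\<lambda>w. f w + g w) = word_mean z s f + word_mean z s g"
proof (induction s arbitrary: f g)
  case (Cons t s)
  then show ?case by (cases t) (simp_all add: average_add)
qed auto

lemma word_mean_sum: "word_mean z s (\<lambda>w. \<Sum>x\<in>T. f x w) = (\<Sum>x\<in>T. word_mean z s (f x))"
proof (induction s arbitrary: f)
  case (Cons t s)
  then show ?case by (cases t) (simp_all add: average_sum)
qed auto

lemma word_mean_append:
  "word_mean z (s @ t) f = word_mean z s (\<lambda>v. word_mean z t (\<lambda>w. f (v @ w)))"
proof (induction s arbitrary: f)
  case (Cons u s)
  then show ?case by (cases u) simp_all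
qed auto

text \<open>A section has one letter for each directed letter of the word. The bound on the length
  of \<open>r\<close> lets an induction on the length supply the comparison.\<close>

lemma pattern_mean_mono:
  assumes "\<And>r. length r \<le> length (filter id s) \<Longrightarrow> g r \<le> h r"
  shows "pattern_mean z x s g \<le> pattern_mean z x s h"
  using assms
proof (induction s arbitrary: g h x)
  case (Cons t s)
  show ?case
  proof (cases t)
    case True
    have "pattern_mean z y s (\<lambda>r. g (u # r)) \<le> pattern_mean z y s (\<lambda>r. h (u # r))" for y u
      by (intro Cons.IH Cons.prems) (auto simp: True)
    then show ?thesis using True by (auto intro: average_mono)
  next
    case False
    have "pattern_mean z y s g \<le> pattern_mean z y s h" for y
      by (intro Cons.IH Cons.prems) (auto simp: False)
    then show ?thesis using False by (auto intro: average_mono)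
  qed
qed auto

lemma pattern_mean_affine:
  "pattern_mean z x s (\<lambda>r. a * g r + b) = a * pattern_mean z x s g + b"
proof (induction s arbitrary: g x)
  case (Cons t s)
  then show ?case by (cases t) (auto intro!: average_affine)
qed auto

lemma pattern_mean_average:
  "pattern_mean z x s (\<lambda>r. average S (\<lambda>b. h b r)) = average S (\<lambda>b. pattern_mean z x s (h b))"
proof (induction s arbitrary: h x)
  case (Cons t s)
  then show ?case by (cases t) (auto intro: average_swap)
qed auto

text \<open>Self-similarity of random words: given its pattern, a section again has independent
  uniform letters. A rooted letter moves the vertex to a uniform position. A directed letter is kept
  at \<open>z\<close>; at another vertex it leaves a uniform rooted letter, independent of the next
  vertex, which is uniform off \<open>z\<close>.\<close>

lemma word_mean_section:
  "word_mean z s (\<lambda>w. f (section_word z x w)) = pattern_mean z x s (\<lambda>r. word_mean z r f)"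
proof (induction s arbitrary: f x)
  case (Cons t s)
  show ?case
  proof (cases t)
    case False
    have "word_mean z (False # s) (\<lambda>w. f (section_word z x w)) =
        average perms (\<lambda>a. pattern_mean z (a x) s (\<lambda>r. word_mean z r f))"
      by (simp add: Cons.IH)
    then show ?thesis
      using average_perms_apply[of "\<lambda>y. pattern_mean z y s (\<lambda>r. word_mean z r f)" x] False by simp
  next
    case True
    show ?thesis
    proof (cases "x = z")
      case eq: True
      have "word_mean z (True # s) (\<lambda>w. f (section_word z x w)) =
          average (carrier (wreath z)) (\<lambda>p. pattern_mean z z s (\<lambda>r. word_mean z r (\<lambda>w. f (Dr p # w))))"
        by (simp add: eq Cons.IH[where f = "\<lambda>w. f (Dr _ # w)"])
      then show ?thesis by (simp add: True eq pattern_mean_average)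
    next
      case neq: False
      have "word_mean z (True # s) (\<lambda>w. f (section_word z x w)) =
          average (carrier (wreath z)) (\<lambda>p. pattern_mean z (snd p x) s
            (\<lambda>r. word_mean z r (\<lambda>w. f (Rt (fst p x) # w))))"
        by (simp add: neq Cons.IH[where f = "\<lambda>w. f (Rt _ # w)"])
      also have "\<dots> = average (- {z}) (\<lambda>y. average perms (\<lambda>a. pattern_mean z y s
            (\<lambda>r. word_mean z r (\<lambda>w. f (Rt a # w)))))"
        by (rule average_wreath_apply[OF neq])
      finally show ?thesis by (simp add: True neq pattern_mean_average)
    qed
  qed
qed auto

section \<open>Expected number of changes in a section\<close>

lemma average_UNIV_le:
  fixes z :: "'a::finite"
  assumes "h z \<le> u" "\<And>y. y \<noteq> z \<Longrightarrow> h y \<le> v"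
  shows "average UNIV h \<le> (u + (real CARD('a) - 1) * v) / CARD('a)"
proof -
  have "sum h UNIV = h z + sum h (- {z})"
    by (simp add: sum.remove[of UNIV z] Compl_eq_Diff_UNIV)
  also have "sum h (- {z}) \<le> (\<Sum>y\<in>- {z}. v)" using assms by (intro sum_mono) auto
  also have "(\<Sum>y\<in>- {z}. v) = (real CARD('a) - 1) * v"
    by (simp add: Compl_eq_Diff_UNIV card_Diff_singleton of_nat_diff Suc_leI)
  finally show ?thesis using assms unfolding average_def by (intro divide_right_mono) auto
qed

context
  fixes z :: "'a::finite" and d q :: real
  assumes d: "d = CARD('a)" and q: "q = (d - 1) / d ^ 2"
begin

lemma d_ge_1: "d \<ge> 1"
  using zero_less_card_finite[where 'a = 'a] by (simp add: d Suc_leI)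

lemma q_nonneg: "q \<ge> 0"
  using d_ge_1 by (simp add: q)

text \<open>After a run of rooted letters the vertex is uniform, so the next run of directed letters
  leaves directed letters with probability \<open>1 / d\<close> and rooted ones otherwise. Two such
  runs differ in kind with probability \<open>2 * (d - 1) / d ^ 2 = 2 * q\<close>, and each costs
  two changes of \<open>s\<close>, hence the rate \<open>q\<close>. The additive term is the
  probability that the next run differs from the last letter of the section, whose kind is
  given.\<close>

lemma pattern_mean_changes_aux:
  shows "pattern_mean z x s (\<lambda>r. changes ((x = z) # r)) \<le>
      q * changes (True # s) + (if x = z then (d - 1) / d else 1 / d)"
    and "average UNIV (\<lambda>y. pattern_mean z y s (\<lambda>r. changes (t # r))) \<le>
      q * (real (changes (False # s)) + 1) + (if t then (d - 1) / d else 1 / d)"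
proof (induction s arbitrary: x t)
  case Nil
  {
    case 1 then show ?case using d_ge_1 q_nonneg by simp
  next
    case 2 then show ?case using d_ge_1 q_nonneg by (simp add: average_def)
  }
next
  case (Cons u s)
  have d0: "d > 0" using d_ge_1 by simp
  have IH: "pattern_mean z y s (\<lambda>r. changes (False # r)) \<le> q * changes (True # s) + 1 / d" if "y \<noteq> z" for y
    using Cons.IH(1)[where x = y] that by simp
  {
    case 1
    show ?case
    proof (cases u)
      case False
      then show ?thesis using Cons.IH(2)[where t = "x = z"] by (simp add: algebra_simps)
    next
      case True
      show ?thesis
      proof (cases "x = z")
        case eq: True
        then show ?thesis using Cons.IH(1)[where x = z] True by simp
      next
        case neq: False
        have "average (- {z}) (\<lambda>y. pattern_mean z y s (\<lambda>r. changes (False # r))) \<le>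
            average (- {z}) (\<lambda>y. q * changes (True # s) + 1 / d)"
          by (intro average_mono IH) auto
        also have "\<dots> = q * changes (True # s) + 1 / d" using neq by (intro average_const) auto
        finally show ?thesis using True neq by simp
      qed
    qed
  next
    case 2
    show ?case
    proof (cases u)
      case False
      then show ?thesis using Cons.IH(2)[where t = t] by (simp add: average_const)
    next
      case True
      let ?c = "q * changes (True # s)"
      let ?h = "\<lambda>y. pattern_mean z y (True # s) (\<lambda>r. changes (t # r))"
      have z: "?h z \<le> (if t then 0 else 1) + (?c + (d - 1) / d)"
        using Cons.IH(1)[where x = z] pattern_mean_affine[of z z s 1 "\<lambda>r. changes (True # r)" "if t then 0 else 1"]
        by (auto simp: add.commute)
      have y: "?h y \<le> (if t then 1 else 0) + (?c + 1 / d)" if "y \<noteq> z" for y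
      proof -
        have "?h y = average (- {z}) (\<lambda>y. pattern_mean z y s (\<lambda>r. 1 * real (changes (False # r)) + (if t then 1 else 0)))"
          using that by (auto simp: add.commute)
        also have "\<dots> \<le> average (- {z}) (\<lambda>y. ?c + 1 / d + (if t then 1 else 0))"
        proof (intro average_mono)
          fix y assume "y \<in> - {z}"
          then show "pattern_mean z y s (\<lambda>r. 1 * real (changes (False # r)) + (if t then 1 else 0)) \<le>
              ?c + 1 / d + (if t then 1 else 0)"
            unfolding pattern_mean_affine using IH[of y] by simp
        qed
        also have "\<dots> = ?c + 1 / d + (if t then 1 else 0)"
          using that by (intro average_const) auto
        finally show ?thesis by simp
      qed
      have "average UNIV ?h \<le> ((if t then 0 else 1) + (?c + (d - 1) / d)
          + (d - 1) * ((if t then 1 else 0) + (?c + 1 / d))) / d"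
        using average_UNIV_le[of ?h z, OF z y] by (simp add: d)
      \<comment> \<open>The additive term reproduces itself: the probability of a change now plus
        the mean of the term at the new vertex is the old term plus \<open>2 * q\<close>.\<close>
      also have "\<dots> = ?c + 2 * q + (if t then (d - 1) / d else 1 / d)"
        using d0 by (simp add: q field_simps power2_eq_square)
      finally show ?thesis using True by (simp add: algebra_simps)
    qed
  }
qed

text \<open>Putting a letter in front of the section can only add a change and makes the preceding
  estimates applicable; their error terms stay below 1.\<close>

lemma pattern_mean_changes: "pattern_mean z x s changes \<le> q * changes s + 1"
proof (cases s)
  case (Cons u v)
  have d0: "d > 0" using d_ge_1 by simp
  have le1: "(if b then (d - 1) / d else 1 / d) \<le> 1" for b using d_ge_1 by auto
  show ?thesis
  proof (cases u)
    case False
    have "q + 1 / d \<le> 1"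
    proof -
      have "0 \<le> (d - 1) ^ 2" by simp
      then have "d - 1 + d \<le> d ^ 2" by (simp add: power2_eq_square algebra_simps)
      then show ?thesis using d0 by (simp add: q field_simps power2_eq_square)
    qed
    moreover have "pattern_mean z x s changes \<le> average UNIV (\<lambda>y. pattern_mean z y v (\<lambda>r. changes (False # r)))"
      using Cons False by (auto intro!: average_mono pattern_mean_mono changes_le_Cons)
    ultimately show ?thesis using pattern_mean_changes_aux(2)[of v False] Cons False
      by (simp add: algebra_simps)
  next
    case True
    have "pattern_mean z x s changes \<le> pattern_mean z x s (\<lambda>r. changes ((x = z) # r))"
      by (intro pattern_mean_mono) (simp add: changes_le_Cons)
    also have "\<dots> \<le> q * changes (True # s) + 1"
      using pattern_mean_changes_aux(1)[of x s] le1[of "x = z"] by linarith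
    finally show ?thesis using Cons True by simp
  qed
qed auto

end

section \<open>Growth of the expected portrait size\<close>

lemma powr_tangent:
  fixes b t y :: real
  assumes "0 < b" "b < 1" "0 < t" "0 < y"
  shows "t powr b \<le> y powr b + b * y powr (b - 1) * (t - y)"
proof -
  \<comment> \<open>Weighted arithmetic-geometric mean inequality; multiplied by
    \<open>y powr (b - 1)\<close> it says that the concave power lies below its tangent at
    \<open>y\<close>.\<close>
  have "t powr b * y powr (1 - b) \<le> b * t + (1 - b) * y"
    using assms by (intro Youngs_inequality_0) auto
  then have "t powr b * y powr (1 - b) * y powr (b - 1) \<le> (b * t + (1 - b) * y) * y powr (b - 1)"
    by (intro mult_right_mono) auto
  moreover have "y powr (1 - b) * y powr (b - 1) = 1" using assms by (simp flip: powr_add)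
  moreover have "y * y powr (b - 1) = y powr b" using assms by (simp add: powr_mult_base)
  ultimately show ?thesis by (simp add: algebra_simps)
qed

text \<open>Jensen's inequality by means of the tangent at \<open>y\<close>; its slope is positive,
  so \<open>y\<close> may exceed the mean.\<close>

lemma pattern_mean_powr_le:
  fixes b y :: real
  assumes "0 < b" "b < 1" "0 < y" "pattern_mean z x s changes + 1 \<le> y"
  shows "pattern_mean z x s (\<lambda>r. (real (changes r) + 1) powr b) \<le> y powr b"
proof -
  let ?k = "b * y powr (b - 1)"
  have "pattern_mean z x s (\<lambda>r. (real (changes r) + 1) powr b) \<le>
      pattern_mean z x s (\<lambda>r. ?k * changes r + (y powr b + ?k * (1 - y)))"
  proof (rule pattern_mean_mono)
    fix r
    show "(real (changes r) + 1) powr b \<le> ?k * changes r + (y powr b + ?k * (1 - y))"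
      using powr_tangent[OF assms(1,2) _ assms(3), of "real (changes r) + 1"] by (simp add: algebra_simps)
  qed
  also have "\<dots> = y powr b + ?k * (pattern_mean z x s changes + 1 - y)"
    unfolding pattern_mean_affine by (simp add: algebra_simps)
  also have "\<dots> \<le> y powr b" using assms by (simp add: mult_nonneg_nonpos)
  finally show ?thesis .
qed

text \<open>After division by \<open>(t + 1) powr b\<close> the left side tends to
  \<open>d * q powr b\<close>, which is below 1.\<close>

lemma contraction_eventually:
  fixes b d q :: real
  assumes "0 < b" "0 < q" "d * q powr b < 1"
  shows "\<forall>\<^sub>F t in at_top. 1 + d * (q * t + 2) powr b \<le> (t + 1) powr b"
proof -
  have lim: "((\<lambda>t. 1 / (t + 1) powr b + d * ((q * t + 2) / (t + 1)) powr b) \<longlongrightarrow> 0 + d * q powr b) at_top"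
  proof (intro tendsto_intros)
    show "((\<lambda>t. 1 / (t + 1) powr b) \<longlongrightarrow> 0) at_top" using assms by real_asymp
    show "((\<lambda>t. (q * t + 2) / (t + 1)) \<longlongrightarrow> q) at_top" by real_asymp
  qed (use assms in auto)
  have "\<forall>\<^sub>F t in at_top. 1 / (t + 1) powr b + d * ((q * t + 2) / (t + 1)) powr b < 1"
    using order_tendstoD(2)[OF lim, of 1] assms by simp
  then show ?thesis using eventually_gt_at_top[of 0]
  proof eventually_elim
    case (elim t)
    have "((q * t + 2) / (t + 1)) powr b = (q * t + 2) powr b / (t + 1) powr b"
      by (simp add: powr_divide)
    with elim have "(1 + d * (q * t + 2) powr b) / (t + 1) powr b < 1" by (simp add: add_divide_distrib)
    then show ?case using elim by (simp add: divide_less_eq)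
  qed
qed

text \<open>Induction on the length of the pattern: a portrait is one node plus the portraits of
  \<open>d\<close> sections, each a random word with at most \<open>q * changes s + 1\<close>
  changes on average.\<close>

lemma word_mean_portrait_size:
  fixes z :: "'a::finite" and b :: real
  assumes "CARD('a) \<ge> 2" "0 < b" "b < 1"
    and "CARD('a) * ((real CARD('a) - 1) / real CARD('a) ^ 2) powr b < 1"
  shows "\<exists>C>0. \<forall>s. word_mean z s (\<lambda>w. real (portrait_size z w)) \<le> C * (real (changes s) + 1) powr b"
proof -
  define d where "d = real CARD('a)"
  define q where "q = (d - 1) / d ^ 2"
  have q0: "q > 0" using assms by (simp add: q_def d_def)
  have "\<forall>\<^sub>F t in at_top. 1 + d * (q * t + 2) powr b \<le> (t + 1) powr b"
    using assms q0 by (intro contraction_eventually) (auto simp: q_def d_def)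
  then obtain T where T: "\<And>t. t \<ge> T \<Longrightarrow> 1 + d * (q * t + 2) powr b \<le> (t + 1) powr b"
    by (auto simp: eventually_at_top_linorder)
  \<comment> \<open>Up to \<open>N\<close> changes the deterministic bound \<open>C\<close>
    suffices; beyond \<open>N\<close> the contraction inequality holds.\<close>
  define N where "N = nat \<lceil>max T 0\<rceil>"
  define C where "C = (d + 1) ^ N"
  have C1: "C \<ge> 1" unfolding C_def d_def by (intro one_le_power) simp
  have "word_mean z s (\<lambda>w. real (portrait_size z w)) \<le> C * (real (changes s) + 1) powr b" for s
  proof (induction "length s" arbitrary: s rule: less_induct)
    case less
    show ?case
    proof (cases "changes s \<le> N")
      case True
      have "word_mean z s (\<lambda>w. real (portrait_size z w)) \<le> word_mean z s (\<lambda>w. C)"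
      proof (rule word_mean_mono)
        fix w assume w: "set w \<subseteq> letters z" "pattern w = s"
        have "portrait_size z w \<le> (CARD('a) + 1) ^ changes s" using portrait_size_le[OF w(1)] w by simp
        also have "\<dots> \<le> (CARD('a) + 1) ^ N" using True by (intro power_increasing) auto
        finally have "real (portrait_size z w) \<le> real ((CARD('a) + 1) ^ N)" by (rule of_nat_mono)
        then show "real (portrait_size z w) \<le> C" by (simp add: C_def d_def add.commute)
      qed
      also have "\<dots> = C * 1" by (simp add: word_mean_const)
      also have "\<dots> \<le> C * (real (changes s) + 1) powr b"
        using C1 assms by (intro mult_left_mono ge_one_powr_ge_zero) auto
      finally show ?thesis .
    next
      case False
      then have pos: "changes s > 0" by simp
      have len: "length (filter id s) < length s" by (rule length_filter_id_less[OF pos])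
      have T': "T \<le> changes s" using False unfolding N_def by linarith
      have "word_mean z s (\<lambda>w. real (portrait_size z w)) =
          word_mean z s (\<lambda>w. (\<Sum>x\<in>UNIV. real (portrait_size z (section_word z x w))) + 1)"
      proof (rule word_mean_cong)
        fix w :: "'a letter list" assume "pattern w = s"
        then show "real (portrait_size z w) = (\<Sum>x\<in>UNIV. real (portrait_size z (section_word z x w))) + 1"
          using pos by (subst portrait_size.simps) simp
      qed
      also have "\<dots> = (\<Sum>x\<in>UNIV. pattern_mean z x s (\<lambda>r. word_mean z r (\<lambda>w. real (portrait_size z w)))) + 1"
        by (simp add: word_mean_add word_mean_const word_mean_sum word_mean_section[where z = z and f = "\<lambda>w. real (portrait_size z w)"])
      also have "\<dots> \<le> (\<Sum>x\<in>(UNIV::'a set). C * (q * changes s + 2) powr b) + 1"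
      proof (intro add_right_mono sum_mono)
        fix x :: 'a
        have "pattern_mean z x s (\<lambda>r. word_mean z r (\<lambda>w. real (portrait_size z w))) \<le>
            pattern_mean z x s (\<lambda>r. C * (real (changes r) + 1) powr b + 0)"
          using less len by (intro pattern_mean_mono) auto
        also have "\<dots> = C * pattern_mean z x s (\<lambda>r. (real (changes r) + 1) powr b)"
          unfolding pattern_mean_affine by simp
        \<comment> \<open>One unit of the 2 is the error in the mean number of changes, the other is
          the shift inside the power.\<close>
        also have "\<dots> \<le> C * (q * changes s + 2) powr b"
          using C1 assms q0 pattern_mean_changes[OF d_def q_def, of z x s]
          by (intro mult_left_mono pattern_mean_powr_le) (auto intro: add_nonneg_pos)
        finally show "pattern_mean z x s (\<lambda>r. word_mean z r (\<lambda>w. real (portrait_size z w))) \<le>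
          C * (q * changes s + 2) powr b" .
      qed
      \<comment> \<open>The root node is absorbed into the factor because
        \<open>C \<ge> 1\<close>.\<close>
      also have "\<dots> \<le> C * (1 + d * (q * changes s + 2) powr b)"
        using C1 by (simp add: d_def algebra_simps)
      also have "\<dots> \<le> C * (real (changes s) + 1) powr b"
        using C1 T[OF T'] by (intro mult_left_mono) auto
      finally show ?thesis .
    qed
  qed
  then show ?thesis using C1 by (intro exI[of _ C]) auto
qed

section \<open>Finitely supported functions on a group\<close>

context group
begin

definition fin_supp :: "('a \<Rightarrow> real) \<Rightarrow> bool" where
  "fin_supp f \<longleftrightarrow> finite {g \<in> carrier G. f g \<noteq> 0}"

text \<open>With an unordered sum over the whole carrier, translations are plain reindexings; for
  finitely supported \<open>f\<close> it is a finite sum.\<close>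

definition gsum :: "('a \<Rightarrow> real) \<Rightarrow> real" where
  "gsum f = (\<Sum>\<^sub>\<infinity>g\<in>carrier G. f g)"

abbreviation sqnorm :: "('a \<Rightarrow> real) \<Rightarrow> real" where
  "sqnorm f \<equiv> gsum (\<lambda>g. (f g)\<^sup>2)"

abbreviation displacement :: "('a \<Rightarrow> real) \<Rightarrow> 'a \<Rightarrow> real" where
  "displacement f x \<equiv> sqnorm (\<lambda>g. f (g \<otimes> x) - f g)"

lemma fin_suppI:
  assumes "finite V" "\<And>g. g \<in> carrier G \<Longrightarrow> g \<notin> V \<Longrightarrow> f g = 0"
  shows "fin_supp f"
  unfolding fin_supp_def by (rule finite_subset[OF _ assms(1)]) (use assms(2) in auto)

lemma fin_supp_add: "fin_supp f \<Longrightarrow> fin_supp h \<Longrightarrow> fin_supp (\<lambda>g. f g + h g)"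
  unfolding fin_supp_def by (rule finite_subset[of _ "{g \<in> carrier G. f g \<noteq> 0} \<union> {g \<in> carrier G. h g \<noteq> 0}"]) auto

lemma fin_supp_diff: "fin_supp f \<Longrightarrow> fin_supp h \<Longrightarrow> fin_supp (\<lambda>g. f g - h g)"
  unfolding fin_supp_def by (rule finite_subset[of _ "{g \<in> carrier G. f g \<noteq> 0} \<union> {g \<in> carrier G. h g \<noteq> 0}"]) auto

lemma fin_supp_mult: "fin_supp f \<Longrightarrow> fin_supp (\<lambda>g. f g * h g)"
  unfolding fin_supp_def by (rule finite_subset[of _ "{g \<in> carrier G. f g \<noteq> 0}"]) auto

lemma fin_supp_cmult: "fin_supp f \<Longrightarrow> fin_supp (\<lambda>g. c * f g)"
  unfolding fin_supp_def by (rule finite_subset[of _ "{g \<in> carrier G. f g \<noteq> 0}"]) auto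

lemma fin_supp_power2: "fin_supp f \<Longrightarrow> fin_supp (\<lambda>g. (f g)\<^sup>2)"
  unfolding fin_supp_def by simp

lemma fin_supp_sum:
  assumes "finite I" "\<And>i. i \<in> I \<Longrightarrow> fin_supp (f i)"
  shows "fin_supp (\<lambda>g. \<Sum>i\<in>I. f i g)"
  using assms
proof (induction I rule: finite_induct)
  case (insert i I)
  then show ?case by (simp add: fin_supp_add)
qed (simp add: fin_supp_def)

lemma bij_betw_mult_right: "x \<in> carrier G \<Longrightarrow> bij_betw (\<lambda>g. g \<otimes> x) (carrier G) (carrier G)"
  by (rule bij_betwI[where g = "\<lambda>g. g \<otimes> inv x"]) (auto simp: m_assoc)

lemma bij_betw_mult_left: "x \<in> carrier G \<Longrightarrow> bij_betw (\<lambda>g. x \<otimes> g) (carrier G) (carrier G)"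
  by (rule bij_betwI[where g = "\<lambda>g. inv x \<otimes> g"]) (auto simp: m_assoc[symmetric])

lemma fin_supp_translate:
  assumes "x \<in> carrier G" "fin_supp f" shows "fin_supp (\<lambda>g. f (g \<otimes> x))"
proof -
  have "{g \<in> carrier G. f (g \<otimes> x) \<noteq> 0} \<subseteq> (\<lambda>g. g \<otimes> inv x) ` {g \<in> carrier G. f g \<noteq> 0}"
  proof
    fix g assume "g \<in> {g \<in> carrier G. f (g \<otimes> x) \<noteq> 0}"
    then show "g \<in> (\<lambda>g. g \<otimes> inv x) ` {g \<in> carrier G. f g \<noteq> 0}"
      using assms by (intro image_eqI[of _ _ "g \<otimes> x"]) (auto simp: m_assoc)
  qed
  then show ?thesis using assms(2) unfolding fin_supp_def by (meson finite_surj)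
qed

lemma fin_supp_summable: "fin_supp f \<Longrightarrow> f summable_on carrier G"
  unfolding fin_supp_def by (rule finite_nonzero_values_imp_summable_on)

lemma gsum_cong: "(\<And>g. g \<in> carrier G \<Longrightarrow> f g = h g) \<Longrightarrow> gsum f = gsum h"
  unfolding gsum_def by (rule infsum_cong)

lemma gsum_add: "fin_supp f \<Longrightarrow> fin_supp h \<Longrightarrow> gsum (\<lambda>g. f g + h g) = gsum f + gsum h"
  unfolding gsum_def by (intro infsum_add fin_supp_summable)

lemma gsum_cmult: "gsum (\<lambda>g. c * f g) = c * gsum f"
  unfolding gsum_def by (rule infsum_cmult_right')

lemma gsum_diff: "fin_supp f \<Longrightarrow> fin_supp h \<Longrightarrow> gsum (\<lambda>g. f g - h g) = gsum f - gsum h"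
  using gsum_add[of f "\<lambda>g. (-1) * h g"] fin_supp_cmult[of h "-1"] gsum_cmult[of "-1" h] by simp

lemma gsum_mono:
  assumes "fin_supp f" "fin_supp h" "\<And>g. g \<in> carrier G \<Longrightarrow> f g \<le> h g"
  shows "gsum f \<le> gsum h"
  unfolding gsum_def using assms by (intro infsum_mono fin_supp_summable)

lemma gsum_nonneg: "(\<And>g. g \<in> carrier G \<Longrightarrow> 0 \<le> f g) \<Longrightarrow> 0 \<le> gsum f"
  unfolding gsum_def by (rule infsum_nonneg)

lemma gsum_sum:
  assumes "finite I" "\<And>i. i \<in> I \<Longrightarrow> fin_supp (f i)"
  shows "gsum (\<lambda>g. \<Sum>i\<in>I. f i g) = (\<Sum>i\<in>I. gsum (f i))"
  using assms
proof (induction I rule: finite_induct)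
  case (insert i I)
  then show ?case using fin_supp_sum[of I f] by (simp add: gsum_add)
qed (simp add: gsum_def)

lemma gsum_translate: "x \<in> carrier G \<Longrightarrow> gsum (\<lambda>g. f (g \<otimes> x)) = gsum f"
  unfolding gsum_def by (rule infsum_reindex_bij_betw[OF bij_betw_mult_right])

lemma gsum_translate_left: "x \<in> carrier G \<Longrightarrow> gsum (\<lambda>g. f (x \<otimes> g)) = gsum f"
  unfolding gsum_def by (rule infsum_reindex_bij_betw[OF bij_betw_mult_left])

lemma gsum_eq_sum:
  assumes "finite V" "V \<subseteq> carrier G" "\<And>g. g \<in> carrier G \<Longrightarrow> g \<notin> V \<Longrightarrow> f g = 0"
  shows "gsum f = sum f V"
proof -
  have "gsum f = infsum f V" unfolding gsum_def using assms by (intro infsum_cong_neutral) auto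
  then show ?thesis using assms by simp
qed

lemma gsum_Cauchy_Schwarz:
  assumes "fin_supp f" "fin_supp h"
  shows "(gsum (\<lambda>g. f g * h g))\<^sup>2 \<le> sqnorm f * sqnorm h"
proof -
  define V where "V = {g \<in> carrier G. f g \<noteq> 0} \<union> {g \<in> carrier G. h g \<noteq> 0}"
  have "finite V" "V \<subseteq> carrier G" using assms by (auto simp: V_def fin_supp_def)
  then have "gsum (\<lambda>g. f g * h g) = (\<Sum>g\<in>V. f g * h g)" "sqnorm f = (\<Sum>g\<in>V. (f g)\<^sup>2)"
      "sqnorm h = (\<Sum>g\<in>V. (h g)\<^sup>2)"
    by (intro gsum_eq_sum; auto simp: V_def)+
  then show ?thesis by (simp add: Cauchy_Schwarz_ineq_sum)
qed

section \<open>Displacement of a function under right translations\<close>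

lemma displacement_expand:
  assumes "x \<in> carrier G" "fin_supp f"
  shows "displacement f x = 2 * sqnorm f - 2 * gsum (\<lambda>g. f (g \<otimes> x) * f g)"
proof -
  note fx = fin_supp_translate[OF assms]
  have "displacement f x = gsum (\<lambda>g. ((f (g \<otimes> x))\<^sup>2 + (f g)\<^sup>2) - 2 * (f (g \<otimes> x) * f g))"
    by (intro gsum_cong) (simp add: power2_diff)
  also have "\<dots> = (sqnorm (\<lambda>g. f (g \<otimes> x)) + sqnorm f) - 2 * gsum (\<lambda>g. f (g \<otimes> x) * f g)"
    using assms fx by (simp add: gsum_diff gsum_add gsum_cmult fin_supp_add fin_supp_power2 fin_supp_mult fin_supp_cmult)
  finally show ?thesis using gsum_translate[OF assms(1), of "\<lambda>g. (f g)\<^sup>2"] by simp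
qed

lemma displacement_nonneg: "displacement f x \<ge> 0"
  by (intro gsum_nonneg) simp

lemma displacement_one: "displacement f \<one> = 0"
  unfolding gsum_def by (rule infsum_0) simp

lemma displacement_inv:
  assumes "x \<in> carrier G" shows "displacement f (inv x) = displacement f x"
proof -
  have "displacement f (inv x) = gsum (\<lambda>g. (f (g \<otimes> x \<otimes> inv x) - f (g \<otimes> x))\<^sup>2)"
    using assms by (intro gsum_translate[symmetric])
  also have "\<dots> = displacement f x"
    using assms by (intro gsum_cong) (simp add: m_assoc power2_commute)
  finally show ?thesis .
qed

lemma square_add_le: "(a + b)\<^sup>2 \<le> 2 * a\<^sup>2 + 2 * (b::real)\<^sup>2"
  using zero_le_power2[of "a - b"] by (simp add: power2_sum power2_diff)

lemma displacement_mult: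
  assumes "x \<in> carrier G" "y \<in> carrier G" "fin_supp f"
  shows "displacement f (x \<otimes> y) \<le> 2 * displacement f x + 2 * displacement f y"
proof -
  note fs = fin_supp_power2 fin_supp_diff fin_supp_translate fin_supp_cmult fin_supp_add assms m_closed
  have "displacement f (x \<otimes> y) \<le>
      gsum (\<lambda>g. 2 * (f (g \<otimes> x) - f g)\<^sup>2 + 2 * (f (g \<otimes> x \<otimes> y) - f (g \<otimes> x))\<^sup>2)"
  proof (intro gsum_mono)
    show "fin_supp (\<lambda>g. (f (g \<otimes> (x \<otimes> y)) - f g)\<^sup>2)" by (intro fs)
    have "fin_supp (\<lambda>g. f (g \<otimes> y) - f g)" by (intro fs)
    from fin_supp_translate[OF assms(1) this]
    show "fin_supp (\<lambda>g. 2 * (f (g \<otimes> x) - f g)\<^sup>2 + 2 * (f (g \<otimes> x \<otimes> y) - f (g \<otimes> x))\<^sup>2)"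
      by (intro fs)
    fix g assume "g \<in> carrier G"
    then show "(f (g \<otimes> (x \<otimes> y)) - f g)\<^sup>2 \<le> 2 * (f (g \<otimes> x) - f g)\<^sup>2 + 2 * (f (g \<otimes> x \<otimes> y) - f (g \<otimes> x))\<^sup>2"
      using square_add_le[of "f (g \<otimes> x) - f g" "f (g \<otimes> x \<otimes> y) - f (g \<otimes> x)"] assms
      by (simp add: m_assoc)
  qed
  also have "\<dots> = 2 * displacement f x + 2 * gsum (\<lambda>g. (f (g \<otimes> x \<otimes> y) - f (g \<otimes> x))\<^sup>2)"
  proof -
    have "fin_supp (\<lambda>g. f (g \<otimes> y) - f g)" by (intro fs)
    from fin_supp_translate[OF assms(1) this] show ?thesis
      by (subst gsum_add) (auto intro!: fs simp: gsum_cmult)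
  qed
  also have "gsum (\<lambda>g. (f (g \<otimes> x \<otimes> y) - f (g \<otimes> x))\<^sup>2) = displacement f y"
    by (rule gsum_translate[OF assms(1), of "\<lambda>g. (f (g \<otimes> y) - f g)\<^sup>2"])
  finally show ?thesis .
qed

text \<open>The constant depends on \<open>x\<close> and \<open>S\<close> but not on
  \<open>f\<close> or \<open>e\<close>. This allows passing from the standard generators to any
  finite generating set and any finitely supported measure.\<close>

lemma displacement_generate:
  assumes "S \<subseteq> carrier G" "x \<in> generate G S"
  shows "\<exists>C\<ge>0. \<forall>f e. fin_supp f \<longrightarrow> (\<forall>s\<in>S. displacement f s \<le> e) \<longrightarrow> displacement f x \<le> C * e"
  using assms(2)
proof (induction x rule: generate.induct)
  case one
  show ?case by (intro exI[of _ 0]) (simp add: displacement_one)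
next
  case (incl s)
  then show ?case by (intro exI[of _ 1]) simp
next
  case (inv s)
  then show ?case using assms by (intro exI[of _ 1]) (auto simp: displacement_inv)
next
  case (eng x y)
  then obtain C D where C: "C \<ge> 0"
      "\<And>f e. fin_supp f \<Longrightarrow> (\<forall>s\<in>S. displacement f s \<le> e) \<Longrightarrow> displacement f x \<le> C * e"
    and D: "D \<ge> 0"
      "\<And>f e. fin_supp f \<Longrightarrow> (\<forall>s\<in>S. displacement f s \<le> e) \<Longrightarrow> displacement f y \<le> D * e"
    by blast
  have xy: "x \<in> carrier G" "y \<in> carrier G" using eng generate_in_carrier[OF assms(1)] by auto
  show ?case
  proof (intro exI[of _ "2 * C + 2 * D"] conjI allI impI)
    fix f e assume f: "fin_supp f" "\<forall>s\<in>S. displacement f s \<le> e"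
    show "displacement f (x \<otimes> y) \<le> (2 * C + 2 * D) * e"
      using displacement_mult[OF xy f(1)] C(2)[OF f] D(2)[OF f] by (simp add: algebra_simps)
  qed (use C D in simp)
qed

lemma displacement_finite_set:
  assumes "S \<subseteq> carrier G" "finite T" "T \<subseteq> generate G S"
  shows "\<exists>C>0. \<forall>f e. fin_supp f \<longrightarrow> (\<forall>s\<in>S. displacement f s \<le> e) \<longrightarrow> 0 \<le> e \<longrightarrow>
    (\<forall>x\<in>T. displacement f x \<le> C * e)"
proof -
  have "\<forall>x\<in>T. \<exists>C\<ge>0. \<forall>f e. fin_supp f \<longrightarrow> (\<forall>s\<in>S. displacement f s \<le> e) \<longrightarrow> displacement f x \<le> C * e"
    using displacement_generate[OF assms(1)] assms(3) by blast
  from bchoice[OF this] obtain C where "\<forall>x\<in>T. 0 \<le> C x \<and>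
      (\<forall>f e. fin_supp f \<longrightarrow> (\<forall>s\<in>S. displacement f s \<le> e) \<longrightarrow> displacement f x \<le> C x * e)" ..
  then have C: "\<And>x. x \<in> T \<Longrightarrow> C x \<ge> 0"
     "\<And>x f e. x \<in> T \<Longrightarrow> fin_supp f \<Longrightarrow> (\<forall>s\<in>S. displacement f s \<le> e) \<Longrightarrow> displacement f x \<le> C x * e"
    by blast+
  have le: "C x \<le> sum C T + 1" if "x \<in> T" for x
    using member_le_sum[OF that, of C] C(1) assms(2) by force
  have "sum C T \<ge> 0" using C(1) by (rule sum_nonneg)
  moreover have "displacement f x \<le> (sum C T + 1) * e"
    if "fin_supp f" "\<forall>s\<in>S. displacement f s \<le> e" "0 \<le> e" "x \<in> T" for f e x
    using C(2)[OF that(4,1,2)] mult_right_mono[OF le[OF that(4)] that(3)] by linarith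
  ultimately show ?thesis by (intro exI[of _ "sum C T + 1"]) auto
qed

section \<open>The killed random walk\<close>

text \<open>Sub-probability distribution at time \<open>k\<close> of the walk from the identity that
  multiplies on the right by a uniform \<open>s i\<close> and dies on leaving
  \<open>V\<close>.\<close>

fun killed_walk :: "'i set \<Rightarrow> ('i \<Rightarrow> 'a) \<Rightarrow> 'a set \<Rightarrow> nat \<Rightarrow> 'a \<Rightarrow> real" where
  "killed_walk I s V 0 g = (if g = \<one> then 1 else 0)"
| "killed_walk I s V (Suc k) g =
    (if g \<in> V then average I (\<lambda>i. killed_walk I s V k (g \<otimes> inv (s i))) else 0)"

context
  fixes I :: "'i set" and s :: "'i \<Rightarrow> 'a" and V :: "'a set"
  assumes I: "finite I" "I \<noteq> {}" and s: "\<And>i. i \<in> I \<Longrightarrow> s i \<in> carrier G"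
    and V: "finite V" "V \<subseteq> carrier G"
begin

abbreviation walk :: "nat \<Rightarrow> 'a \<Rightarrow> real" where
  "walk \<equiv> killed_walk I s V"

lemma killed_walk_outside: "\<one> \<in> V \<Longrightarrow> g \<notin> V \<Longrightarrow> walk k g = 0"
  by (cases k) auto

lemma fin_supp_walk: "fin_supp (walk k)"
proof (cases k)
  case 0 then show ?thesis by (intro fin_suppI[of "{\<one>}"]) auto
next
  case (Suc n) then show ?thesis using V by (intro fin_suppI[of V]) auto
qed

text \<open>Variance identity: for \<open>m = card I\<close> numbers \<open>u i\<close>, the sum of
  \<open>(u i - u j)^2\<close> over all pairs is \<open>2 m\<close> times the sum of squares minus
  twice the square of the sum. Averaging the translates of the walk function loses squared norm in
  proportion to this quantity, and killing only loses more.\<close>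

lemma killed_walk_difference:
  assumes "i \<in> I" "j \<in> I"
  shows "sqnorm (\<lambda>g. walk k (g \<otimes> inv (s i)) - walk k (g \<otimes> inv (s j))) \<le>
    2 * (real (card I))\<^sup>2 * (sqnorm (walk k) - sqnorm (walk (Suc k)))"
proof -
  let ?f = "walk k" and ?m = "real (card I)"
  have m: "?m > 0" using I by (simp add: card_gt_0_iff)
  have fs: "fin_supp (\<lambda>g. ?f (g \<otimes> inv (s i)))" if "i \<in> I" for i
    using that s fin_supp_walk by (intro fin_supp_translate) auto
  have pt: "(?f (g \<otimes> inv (s i)) - ?f (g \<otimes> inv (s j)))\<^sup>2 \<le>
      2 * ?m * (\<Sum>i\<in>I. (?f (g \<otimes> inv (s i)))\<^sup>2) - 2 * ?m\<^sup>2 * (walk (Suc k) g)\<^sup>2" for g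
  proof -
    define u where "u i = ?f (g \<otimes> inv (s i))" for i
    have "(u i - u j)\<^sup>2 \<le> (\<Sum>j\<in>I. (u i - u j)\<^sup>2)"
      using assms I by (intro member_le_sum[of j I "\<lambda>j. (u i - u j)\<^sup>2"]) auto
    also have "\<dots> \<le> (\<Sum>i\<in>I. \<Sum>j\<in>I. (u i - u j)\<^sup>2)"
      using assms I by (intro member_le_sum[of i I "\<lambda>i. \<Sum>j\<in>I. (u i - u j)\<^sup>2"]) (auto intro: sum_nonneg)
    also have "\<dots> = 2 * ?m * (\<Sum>i\<in>I. (u i)\<^sup>2) - 2 * (sum u I)\<^sup>2"
      by (simp add: power2_diff sum.distrib sum_subtractf sum_distrib_left[symmetric]
          sum_distrib_right[symmetric] power2_eq_square[of "sum u I"] mult.assoc)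
    \<comment> \<open>On \<open>V\<close> the next value is the mean of the \<open>u i\<close>, off
      \<open>V\<close> it is 0; the estimate holds in both cases.\<close>
    also have "\<dots> \<le> 2 * ?m * (\<Sum>i\<in>I. (u i)\<^sup>2) - 2 * ?m\<^sup>2 * (walk (Suc k) g)\<^sup>2"
      using m by (auto simp: average_def u_def power_divide)
    finally show ?thesis by (simp add: u_def)
  qed
  have fs2: "fin_supp (\<lambda>g. \<Sum>i\<in>I. (?f (g \<otimes> inv (s i)))\<^sup>2)"
    using I fs by (intro fin_supp_sum fin_supp_power2)
  have "sqnorm (\<lambda>g. ?f (g \<otimes> inv (s i)) - ?f (g \<otimes> inv (s j))) \<le>
      gsum (\<lambda>g. 2 * ?m * (\<Sum>i\<in>I. (?f (g \<otimes> inv (s i)))\<^sup>2) - 2 * ?m\<^sup>2 * (walk (Suc k) g)\<^sup>2)"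
    by (rule gsum_mono[OF _ _ pt])
      (intro fin_supp_power2 fin_supp_diff fs assms fin_supp_cmult fs2 fin_supp_walk)+
  also have "\<dots> = 2 * ?m * (\<Sum>i\<in>I. gsum (\<lambda>g. (?f (g \<otimes> inv (s i)))\<^sup>2)) - 2 * ?m\<^sup>2 * sqnorm (walk (Suc k))"
    using I(1) by (simp add: gsum_diff gsum_cmult gsum_sum fs fs2 fin_supp_power2 fin_supp_cmult
      fin_supp_walk del: killed_walk.simps)
  also have "(\<Sum>i\<in>I. gsum (\<lambda>g. (?f (g \<otimes> inv (s i)))\<^sup>2)) = (\<Sum>i\<in>I. sqnorm ?f)"
    using s by (intro sum.cong refl gsum_translate[where f = "\<lambda>g. (?f g)\<^sup>2"]) auto
  finally show ?thesis by (simp add: algebra_simps power2_eq_square del: killed_walk.simps)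
qed

text \<open>The squared norm starts at 1 and is at least \<open>1 / (4 * card V)\<close> at time
  \<open>n\<close>, so some step multiplies it by at least \<open>1 - e\<close>, and the function
  just before that step is taken. The trivial step \<open>i0\<close> lets translates be compared
  with the function itself.\<close>

lemma killed_walk_almost_invariant:
  assumes n: "n \<ge> 1" and one: "\<one> \<in> V" and mass: "sum (walk n) V \<ge> 1 / 2"
    and i0: "i0 \<in> I" "s i0 = \<one>"
  shows "\<exists>f. (\<forall>g. g \<notin> V \<longrightarrow> f g = 0) \<and> sqnorm f > 0 \<and>
    (\<forall>i\<in>I. displacement f (s i) \<le> 2 * (real (card I))\<^sup>2 * (ln (4 * card V) / n) * sqnorm f)"
proof -
  define N where "N k = sqnorm (walk k)" for k
  define e where "e = ln (4 * card V) / n"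
  have cV: "card V > 0" using one V by (auto simp: card_gt_0_iff)
  have N0: "N 0 = 1"
    unfolding N_def by (subst gsum_eq_sum[of "{\<one>}"]) auto
  have N_nonneg: "N k \<ge> 0" for k unfolding N_def by (intro gsum_nonneg) auto
  \<comment> \<open>Cauchy-Schwarz against the constant 1 on \<open>V\<close> turns the mass bound
    into a bound for the squared norm.\<close>
  have "(1 / 2)\<^sup>2 \<le> (sum (walk n) V)\<^sup>2" using mass by (intro power_mono) auto
  also have "\<dots> \<le> (\<Sum>g\<in>V. (walk n g)\<^sup>2) * (\<Sum>g\<in>V. 1\<^sup>2)"
    using Cauchy_Schwarz_ineq_sum[of "walk n" "\<lambda>_. 1" V] by simp
  also have "(\<Sum>g\<in>V. (walk n g)\<^sup>2) = N n"
    unfolding N_def using V one by (intro gsum_eq_sum[symmetric]) (auto simp: killed_walk_outside)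
  finally have Nn: "N n \<ge> 1 / (4 * card V)" using cV by (simp add: field_simps)
  have "\<exists>k<n. N k > 0 \<and> N k - N (Suc k) \<le> e * N k"
  proof (rule ccontr)
    assume neg: "\<not> ?thesis"
    have step: "N (Suc k) < exp (- e) * N k" if "N k > 0" "k < n" for k
    proof -
      have "N (Suc k) < (1 - e) * N k" using neg that by (auto simp: algebra_simps)
      also have "\<dots> \<le> exp (- e) * N k" using exp_ge_add_one_self[of "- e"] that by (intro mult_right_mono) auto
      finally show ?thesis .
    qed
    \<comment> \<open>For equal indices the difference vanishes, and what remains is that the norm
      does not grow.\<close>
    have zero: "N (Suc k) = 0" if "N k = 0" "k < n" for k
      using killed_walk_difference[OF i0(1) i0(1), of k] that N_nonneg[of "Suc k"] I
      by (auto simp: N_def gsum_def card_gt_0_iff mult_le_0_iff simp del: killed_walk.simps)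
    \<comment> \<open>Strictness for \<open>k > 0\<close> is what contradicts the lower bound at
      time \<open>n\<close>.\<close>
    have "N k \<le> exp (- e) ^ k \<and> (k > 0 \<longrightarrow> N k < exp (- e) ^ k)" if "k \<le> n" for k
      using that
    proof (induction k)
      case (Suc k)
      then have IH: "N k \<le> exp (- e) ^ k" by simp
      have "N (Suc k) < exp (- e) ^ Suc k"
      proof (cases "N k > 0")
        case True
        then have "N (Suc k) < exp (- e) * N k" using step Suc by simp
        also have "\<dots> \<le> exp (- e) * exp (- e) ^ k" using IH by (intro mult_left_mono) auto
        finally show ?thesis by simp
      next
        case False
        then have "N (Suc k) = 0" using zero[of k] N_nonneg[of k] Suc by simp
        then show ?thesis by simp
      qed
      then show ?case by simp
    qed (simp add: N0)
    from this[of n] have "N n < exp (- e) ^ n" using n by simp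
    also have "exp (- e) ^ n = exp (- ln (4 * card V))"
      using n by (simp add: e_def exp_of_nat_mult[symmetric])
    also have "\<dots> = 1 / (4 * card V)" using cV by (simp only: exp_minus exp_ln of_nat_0_less_iff mult_pos_pos zero_less_numeral inverse_eq_divide)
    finally show False using Nn by simp
  qed
  then obtain k where k: "N k > 0" "N k - N (Suc k) \<le> e * N k" by auto
  show ?thesis
  proof (intro exI[of _ "walk k"] conjI ballI allI impI)
    fix i assume i: "i \<in> I"
    have "displacement (walk k) (s i) = displacement (walk k) (inv (s i))"
      using displacement_inv[OF s[OF i]] by simp
    also have "\<dots> = sqnorm (\<lambda>g. walk k (g \<otimes> inv (s i)) - walk k (g \<otimes> inv (s i0)))"
      by (intro gsum_cong) (simp add: i0)
    also have "\<dots> \<le> 2 * (real (card I))\<^sup>2 * (N k - N (Suc k))"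
      unfolding N_def by (rule killed_walk_difference[OF i i0(1)])
    also have "\<dots> \<le> 2 * (real (card I))\<^sup>2 * (e * N k)"
      using k by (intro mult_left_mono) auto
    finally show "displacement (walk k) (s i) \<le> 2 * (real (card I))\<^sup>2 * (ln (4 * card V) / n) * sqnorm (walk k)"
      by (simp add: e_def N_def)
  qed (use k one killed_walk_outside in \<open>auto simp: N_def\<close>)
qed

end

section \<open>Return probabilities\<close>

context
  fixes \<mu> :: "'a pmf"
  assumes supp: "set_pmf \<mu> \<subseteq> carrier G" "finite (set_pmf \<mu>)"
    and sym: "\<And>g. g \<in> carrier G \<Longrightarrow> pmf \<mu> (inv g) = pmf \<mu> g"
begin

text \<open>The convolution operator of \<open>\<mu>\<close>; by symmetry of \<open>\<mu>\<close>,
  \<open>g \<otimes> h\<close> can stand in place of \<open>g \<otimes> inv h\<close>.\<close>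

definition markov :: "('a \<Rightarrow> real) \<Rightarrow> 'a \<Rightarrow> real" where
  "markov f g = (\<Sum>h\<in>set_pmf \<mu>. pmf \<mu> h * f (g \<otimes> h))"

lemma set_pmf_inv: "h \<in> set_pmf \<mu> \<Longrightarrow> inv h \<in> set_pmf \<mu>"
  using supp sym by (auto simp: set_pmf_iff)

lemma sum_set_pmf_inv: "(\<Sum>h\<in>set_pmf \<mu>. pmf \<mu> h * F (inv h)) = (\<Sum>h\<in>set_pmf \<mu>. pmf \<mu> h * F h)"
proof -
  have "(\<Sum>h\<in>set_pmf \<mu>. pmf \<mu> h * F (inv h)) = (\<Sum>h\<in>set_pmf \<mu>. pmf \<mu> (inv h) * F (inv h))"
    using supp sym by (intro sum.cong) auto
  also have "\<dots> = (\<Sum>h\<in>set_pmf \<mu>. pmf \<mu> h * F h)"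
    by (rule sum.reindex_bij_betw[of "\<lambda>h. inv h"])
      (rule bij_betwI[where g = "\<lambda>h. inv h"], use supp set_pmf_inv in auto)
  finally show ?thesis .
qed

lemma fin_supp_markov: "fin_supp f \<Longrightarrow> fin_supp (markov f)"
  unfolding markov_def using supp
  by (intro fin_supp_sum fin_supp_cmult fin_supp_translate) auto

lemma fin_supp_markov_power: "fin_supp f \<Longrightarrow> fin_supp ((markov ^^ n) f)"
  by (induction n) (auto intro: fin_supp_markov)

lemma gsum_markov:
  assumes "fin_supp f"
  shows "gsum (\<lambda>g. markov f g * h g) = (\<Sum>x\<in>set_pmf \<mu>. pmf \<mu> x * gsum (\<lambda>g. f (g \<otimes> x) * h g))"
proof -
  have "gsum (\<lambda>g. markov f g * h g) = gsum (\<lambda>g. \<Sum>x\<in>set_pmf \<mu>. pmf \<mu> x * (f (g \<otimes> x) * h g))"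
    by (intro gsum_cong) (simp add: markov_def sum_distrib_right mult.assoc)
  also have "\<dots> = (\<Sum>x\<in>set_pmf \<mu>. gsum (\<lambda>g. pmf \<mu> x * (f (g \<otimes> x) * h g)))"
    using supp assms by (intro gsum_sum fin_supp_cmult fin_supp_mult fin_supp_translate) auto
  finally show ?thesis by (simp add: gsum_cmult)
qed

text \<open>Translation by \<open>x\<close> is adjoint to translation by \<open>inv x\<close>, and
  \<open>\<mu>\<close> gives both the same weight.\<close>

lemma markov_self_adjoint:
  assumes "fin_supp f" "fin_supp h"
  shows "gsum (\<lambda>g. markov f g * h g) = gsum (\<lambda>g. f g * markov h g)"
proof -
  have "gsum (\<lambda>g. f (g \<otimes> x) * h g) = gsum (\<lambda>g. h (g \<otimes> inv x) * f g)" if "x \<in> set_pmf \<mu>" for x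
  proof -
    have x: "x \<in> carrier G" using that supp by auto
    have "gsum (\<lambda>g. h (g \<otimes> inv x) * f g) = gsum (\<lambda>g. h (g \<otimes> x \<otimes> inv x) * f (g \<otimes> x))"
      by (rule gsum_translate[OF x, symmetric])
    also have "\<dots> = gsum (\<lambda>g. f (g \<otimes> x) * h g)"
      using x by (intro gsum_cong) (simp add: m_assoc)
    finally show ?thesis by simp
  qed
  then have "gsum (\<lambda>g. markov f g * h g) = (\<Sum>x\<in>set_pmf \<mu>. pmf \<mu> x * gsum (\<lambda>g. h (g \<otimes> inv x) * f g))"
    by (simp add: gsum_markov assms)
  also have "\<dots> = (\<Sum>x\<in>set_pmf \<mu>. pmf \<mu> x * gsum (\<lambda>g. h (g \<otimes> x) * f g))"
    by (rule sum_set_pmf_inv)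
  also have "\<dots> = gsum (\<lambda>g. markov h g * f g)" by (simp add: gsum_markov assms)
  finally show ?thesis by (simp add: mult.commute)
qed

lemma markov_power_self_adjoint:
  assumes "fin_supp f" "fin_supp h"
  shows "gsum (\<lambda>g. (markov ^^ n) f g * h g) = gsum (\<lambda>g. f g * (markov ^^ n) h g)"
  using assms
proof (induction n arbitrary: h)
  case (Suc n)
  have "gsum (\<lambda>g. (markov ^^ Suc n) f g * h g) = gsum (\<lambda>g. (markov ^^ n) f g * markov h g)"
    using Suc.prems by (simp add: markov_self_adjoint fin_supp_markov_power)
  also have "\<dots> = gsum (\<lambda>g. f g * (markov ^^ n) (markov h) g)"
    using Suc by (intro Suc.IH fin_supp_markov)
  finally show ?case by (simp add: funpow_swap1)
qed simp

lemma sum_pmf_support: "(\<Sum>h\<in>set_pmf \<mu>. pmf \<mu> h) = 1"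
  using supp(2) by (rule sum_pmf_eq_1) simp

text \<open>Expanding the displacement bounds each inner product of \<open>f\<close> with its
  translate from below; averaging over \<open>\<mu>\<close> bounds the Rayleigh quotient.\<close>

lemma gsum_markov_ge:
  assumes "fin_supp f" "\<And>h. h \<in> set_pmf \<mu> \<Longrightarrow> displacement f h \<le> 2 * e * sqnorm f"
  shows "gsum (\<lambda>g. markov f g * f g) \<ge> (1 - e) * sqnorm f"
proof -
  have "(1 - e) * sqnorm f = (\<Sum>h\<in>set_pmf \<mu>. pmf \<mu> h * ((1 - e) * sqnorm f))"
    by (simp flip: sum_distrib_right add: sum_pmf_support)
  also have "\<dots> \<le> (\<Sum>h\<in>set_pmf \<mu>. pmf \<mu> h * gsum (\<lambda>g. f (g \<otimes> h) * f g))"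
  proof (intro sum_mono mult_left_mono)
    fix h assume h: "h \<in> set_pmf \<mu>"
    then have "h \<in> carrier G" using supp by auto
    from displacement_expand[OF this assms(1)] assms(2)[OF h]
    show "(1 - e) * sqnorm f \<le> gsum (\<lambda>g. f (g \<otimes> h) * f g)" by (simp add: algebra_simps)
  qed simp
  also have "\<dots> = gsum (\<lambda>g. markov f g * f g)" by (rule gsum_markov[OF assms(1), symmetric])
  finally show ?thesis .
qed

text \<open>By self-adjointness \<open>\<parallel>P\<^sup>k f\<parallel>\<^sup>2\<close> is logarithmically convex in \<open>k\<close>, so the first ratio
  bounds all later ones from below.\<close>

lemma sqnorm_markov_power_ge:
  assumes f: "fin_supp f" "\<And>h. h \<in> set_pmf \<mu> \<Longrightarrow> displacement f h \<le> 2 * e * sqnorm f"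
    and e: "e \<le> 1" and pos: "sqnorm f > 0"
  shows "sqnorm ((markov ^^ n) f) \<ge> (1 - e) ^ (2 * n) * sqnorm f"
proof -
  define a where "a k = sqnorm ((markov ^^ k) f)" for k
  define c where "c = (1 - e)\<^sup>2"
  have fs: "fin_supp ((markov ^^ k) f)" for k by (rule fin_supp_markov_power[OF f(1)])
  have a_nonneg: "a k \<ge> 0" for k unfolding a_def by (intro gsum_nonneg) simp
  have a0: "a 0 = sqnorm f" by (simp add: a_def)
  have convex: "(a (Suc k))\<^sup>2 \<le> a k * a (Suc (Suc k))" for k
  proof -
    have "a (Suc k) = gsum (\<lambda>g. markov ((markov ^^ k) f) g * (markov ^^ Suc k) f g)"
      by (simp add: a_def power2_eq_square)
    also have "\<dots> = gsum (\<lambda>g. (markov ^^ k) f g * markov ((markov ^^ Suc k) f) g)"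
      by (rule markov_self_adjoint[OF fs fs])
    also have "\<dots> = gsum (\<lambda>g. (markov ^^ k) f g * (markov ^^ Suc (Suc k)) f g)" by simp
    finally show ?thesis unfolding a_def
      using gsum_Cauchy_Schwarz[OF fs[of k] fs[of "Suc (Suc k)"]] by simp
  qed
  have "((1 - e) * a 0)\<^sup>2 \<le> (gsum (\<lambda>g. markov f g * f g))\<^sup>2"
    using gsum_markov_ge[OF f] e a_nonneg[of 0] unfolding a0 by (intro power_mono mult_nonneg_nonneg) auto
  also have "\<dots> \<le> a 1 * a 0"
    using gsum_Cauchy_Schwarz[OF fs[of 1] fs[of 0]] by (simp add: a_def)
  finally have "a 0 * (c * a 0) \<le> a 0 * a 1" by (simp add: c_def power2_eq_square algebra_simps)
  then have first: "c * a 0 \<le> a 1" using pos a0 by simp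
  have step: "c * a k \<le> a (Suc k)" for k
  proof (induction k)
    case (Suc k)
    show ?case
    proof (cases "a (Suc k) = 0")
      case True then show ?thesis using a_nonneg by simp
    next
      case False
      then have pos1: "a (Suc k) > 0" using a_nonneg[of "Suc k"] by simp
      have "a k \<noteq> 0" using convex[of k] pos1 by auto
      then have pos0: "a k > 0" using a_nonneg[of k] by simp
      have "a k * (c * a (Suc k)) = (c * a k) * a (Suc k)" by simp
      also have "\<dots> \<le> a (Suc k) * a (Suc k)" using Suc pos1 by (intro mult_right_mono) auto
      also have "\<dots> \<le> a k * a (Suc (Suc k))" using convex[of k] by (simp add: power2_eq_square)
      finally show ?thesis using pos0 by simp
    qed
  qed (use first in simp)
  have "c ^ n * a 0 \<le> a n"
  proof (induction n)
    case (Suc n)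
    have "c ^ Suc n * a 0 = c * (c ^ n * a 0)" by simp
    also have "\<dots> \<le> c * a n" using Suc by (intro mult_left_mono) (auto simp: c_def)
    also have "\<dots> \<le> a (Suc n)" by (rule step)
    finally show ?case .
  qed simp
  then show ?thesis by (simp add: a_def c_def power_mult)
qed

section \<open>Return probability as a squared norm\<close>

abbreviation delta :: "'a \<Rightarrow> real" where
  "delta g \<equiv> (if g = \<one> then 1 else 0)"

lemma fin_supp_delta: "fin_supp delta"
  by (rule fin_suppI[of "{\<one>}"]) auto

lemma set_conv_power: "set_pmf (conv_power G \<mu> n) \<subseteq> carrier G"
proof (induction n)
  case (Suc n)
  then show ?case using supp(1) by (auto simp: subset_iff)
qed simp

lemma pmf_conv_power: "g \<in> carrier G \<Longrightarrow> pmf (conv_power G \<mu> n) g = (markov ^^ n) delta g"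
proof (induction n arbitrary: g)
  case 0 then show ?case by (auto simp: pmf_return)
next
  case (Suc n)
  let ?A = "conv_power G \<mu> n"
  \<comment> \<open>Conditioning on the last step \<open>h\<close> writes the law as a mixture of
    right translates.\<close>
  have "conv_power G \<mu> (Suc n) = map_pmf (\<lambda>(h, g). g \<otimes> h) (pair_pmf \<mu> ?A)"
    by (subst pair_commute_pmf) (simp add: pmf.map_comp comp_def split_def)
  also have "\<dots> = bind_pmf \<mu> (\<lambda>h. map_pmf (\<lambda>g. g \<otimes> h) ?A)"
    by (simp add: pair_pmf_def map_bind_pmf map_pmf_def bind_assoc_pmf bind_return_pmf)
  finally have eq: "conv_power G \<mu> (Suc n) = bind_pmf \<mu> (\<lambda>h. map_pmf (\<lambda>g. g \<otimes> h) ?A)" .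
  have "pmf (conv_power G \<mu> (Suc n)) g = (\<Sum>h\<in>set_pmf \<mu>. pmf \<mu> h * pmf (map_pmf (\<lambda>g. g \<otimes> h) ?A) g)"
    unfolding eq pmf_bind by (subst integral_measure_pmf_real[OF supp(2)]) (auto simp: mult.commute)
  also have "\<dots> = (\<Sum>h\<in>set_pmf \<mu>. pmf \<mu> h * pmf ?A (g \<otimes> inv h))"
  proof (intro sum.cong refl arg_cong2[where f = "(*)"])
    fix h assume "h \<in> set_pmf \<mu>"
    then have h: "h \<in> carrier G" using supp by auto
    show "pmf (map_pmf (\<lambda>g. g \<otimes> h) ?A) g = pmf ?A (g \<otimes> inv h)"
    proof (cases "g \<otimes> inv h \<in> set_pmf ?A")
      case True
      have "inj_on (\<lambda>g. g \<otimes> h) (set_pmf ?A)"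
        by (rule inj_on_subset[OF bij_betw_imp_inj_on[OF bij_betw_mult_right[OF h]] set_conv_power])
      from pmf_map_inj[OF this True] show ?thesis using h Suc.prems by (simp add: m_assoc)
    next
      case False
      have "g \<notin> (\<lambda>g. g \<otimes> h) ` set_pmf ?A"
        using False set_conv_power[of n] h Suc.prems by (auto simp: m_assoc)
      then have "g \<notin> set_pmf (map_pmf (\<lambda>g. g \<otimes> h) ?A)" by simp
      then have "pmf (map_pmf (\<lambda>g. g \<otimes> h) ?A) g = 0" by (simp only: set_pmf_iff not_not)
      moreover have "pmf ?A (g \<otimes> inv h) = 0" using False by (simp only: set_pmf_iff not_not)
      ultimately show ?thesis by simp
    qed
  qed
  also have "\<dots> = (\<Sum>h\<in>set_pmf \<mu>. pmf \<mu> h * (markov ^^ n) delta (g \<otimes> inv h))"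
    using supp Suc by (intro sum.cong) auto
  also have "\<dots> = (\<Sum>h\<in>set_pmf \<mu>. pmf \<mu> h * (markov ^^ n) delta (g \<otimes> h))"
    by (rule sum_set_pmf_inv)
  finally show ?case by (simp add: markov_def[of "(markov ^^ n) delta"])
qed

text \<open>Self-adjointness moves all \<open>2 * n\<close> steps to one factor, and pairing with
  \<open>delta\<close> evaluates at the identity.\<close>

lemma sqnorm_markov_power_delta: "sqnorm ((markov ^^ n) delta) = pmf (conv_power G \<mu> (2 * n)) \<one>"
proof -
  have "sqnorm ((markov ^^ n) delta) = gsum (\<lambda>g. (markov ^^ n) delta g * (markov ^^ n) delta g)"
    by (simp add: power2_eq_square)
  also have "\<dots> = gsum (\<lambda>g. delta g * (markov ^^ n) ((markov ^^ n) delta) g)"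
    by (intro markov_power_self_adjoint fin_supp_markov_power fin_supp_delta)
  also have "\<dots> = gsum (\<lambda>g. delta g * (markov ^^ (2 * n)) delta g)"
    by (simp add: mult_2 funpow_add)
  also have "\<dots> = (markov ^^ (2 * n)) delta \<one>"
    by (subst gsum_eq_sum[of "{\<one>}"]) auto
  also have "\<dots> = pmf (conv_power G \<mu> (2 * n)) \<one>" by (simp add: pmf_conv_power)
  finally show ?thesis .
qed

text \<open>The operator acts by right translations, so it commutes with left ones, and
  \<open>f\<close> is a combination of left translates of \<open>delta\<close>.\<close>

lemma markov_power_convolution:
  assumes V: "finite V" "V \<subseteq> carrier G" "\<And>g. g \<in> carrier G \<Longrightarrow> g \<notin> V \<Longrightarrow> f g = 0" and "g \<in> carrier G"
  shows "(markov ^^ n) f g = (\<Sum>v\<in>V. f v * (markov ^^ n) delta (inv v \<otimes> g))"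
  using assms(4)
proof (induction n arbitrary: g)
  case 0
  have "inv v \<otimes> g = \<one> \<longleftrightarrow> v = g" if "v \<in> V" for v
    using that V 0 by (metis inv_closed inv_equality inv_inv l_inv subsetD)
  then have "(\<Sum>v\<in>V. f v * delta (inv v \<otimes> g)) = (\<Sum>v\<in>V. if v = g then f v else 0)"
    by (intro sum.cong) auto
  then show ?case using V 0 by auto
next
  case (Suc n)
  have "(markov ^^ Suc n) f g = (\<Sum>h\<in>set_pmf \<mu>. pmf \<mu> h * (\<Sum>v\<in>V. f v * (markov ^^ n) delta (inv v \<otimes> (g \<otimes> h))))"
  proof -
    have "(markov ^^ n) f (g \<otimes> h) = (\<Sum>v\<in>V. f v * (markov ^^ n) delta (inv v \<otimes> (g \<otimes> h)))"
      if "h \<in> set_pmf \<mu>" for h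
      using that supp Suc.prems by (intro Suc.IH) auto
    then show ?thesis by (simp add: markov_def[of "(markov ^^ n) f"])
  qed
  also have "\<dots> = (\<Sum>v\<in>V. \<Sum>h\<in>set_pmf \<mu>. pmf \<mu> h * (f v * (markov ^^ n) delta (inv v \<otimes> (g \<otimes> h))))"
    unfolding sum_distrib_left by (rule sum.swap)
  also have "\<dots> = (\<Sum>v\<in>V. f v * (\<Sum>h\<in>set_pmf \<mu>. pmf \<mu> h * (markov ^^ n) delta (inv v \<otimes> g \<otimes> h)))"
  proof (intro sum.cong refl)
    fix v assume v: "v \<in> V"
    show "(\<Sum>h\<in>set_pmf \<mu>. pmf \<mu> h * (f v * (markov ^^ n) delta (inv v \<otimes> (g \<otimes> h)))) =
        f v * (\<Sum>h\<in>set_pmf \<mu>. pmf \<mu> h * (markov ^^ n) delta (inv v \<otimes> g \<otimes> h))"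
      unfolding sum_distrib_left
    proof (intro sum.cong refl)
      fix h assume "h \<in> set_pmf \<mu>"
      then have "v \<in> carrier G" "h \<in> carrier G" using supp V v by auto
      then have "inv v \<otimes> (g \<otimes> h) = inv v \<otimes> g \<otimes> h" using Suc.prems by (simp add: m_assoc)
      then show "pmf \<mu> h * (f v * (markov ^^ n) delta (inv v \<otimes> (g \<otimes> h))) =
          f v * (pmf \<mu> h * (markov ^^ n) delta (inv v \<otimes> g \<otimes> h))" by simp
    qed
  qed
  finally show ?case by (simp add: markov_def[of "(markov ^^ n) delta"])
qed

text \<open>Cauchy-Schwarz in the convolution formula, pointwise in \<open>g\<close>. Summed over
  \<open>g\<close>, each of the \<open>card V\<close> left translates of
  \<open>(markov ^^ n) delta\<close> contributes the return probability.\<close>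

lemma sqnorm_markov_power_le:
  assumes V: "finite V" "V \<subseteq> carrier G" "\<And>g. g \<in> carrier G \<Longrightarrow> g \<notin> V \<Longrightarrow> f g = 0"
  shows "sqnorm ((markov ^^ n) f) \<le> card V * sqnorm f * pmf (conv_power G \<mu> (2 * n)) \<one>"
proof -
  let ?p = "(markov ^^ n) delta"
  have fsf: "fin_supp f" using V by (intro fin_suppI)
  have fsp: "fin_supp ?p" by (intro fin_supp_markov_power fin_supp_delta)
  have tr: "sqnorm (\<lambda>g. ?p (inv v \<otimes> g)) = sqnorm ?p" if "v \<in> V" for v
    using that V gsum_translate_left[of "inv v" "\<lambda>g. (?p g)\<^sup>2"] by auto
  have fst: "fin_supp (\<lambda>g. ?p (inv v \<otimes> g))" if "v \<in> V" for v
  proof -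
    have v: "v \<in> carrier G" using that V by auto
    have "{g \<in> carrier G. ?p (inv v \<otimes> g) \<noteq> 0} \<subseteq> (\<lambda>g. v \<otimes> g) ` {g \<in> carrier G. ?p g \<noteq> 0}"
    proof
      fix g assume "g \<in> {g \<in> carrier G. ?p (inv v \<otimes> g) \<noteq> 0}"
      then show "g \<in> (\<lambda>g. v \<otimes> g) ` {g \<in> carrier G. ?p g \<noteq> 0}"
        using v by (intro image_eqI[of _ _ "inv v \<otimes> g"]) (auto simp: m_assoc[symmetric])
    qed
    then show ?thesis using fsp unfolding fin_supp_def by (meson finite_surj)
  qed
  have "sqnorm ((markov ^^ n) f) \<le> gsum (\<lambda>g. sqnorm f * (\<Sum>v\<in>V. (?p (inv v \<otimes> g))\<^sup>2))"
  proof (intro gsum_mono)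
    show "fin_supp (\<lambda>g. ((markov ^^ n) f g)\<^sup>2)" by (intro fin_supp_power2 fin_supp_markov_power fsf)
    show "fin_supp (\<lambda>g. sqnorm f * (\<Sum>v\<in>V. (?p (inv v \<otimes> g))\<^sup>2))"
      using V by (intro fin_supp_cmult fin_supp_sum fin_supp_power2 fst)
    fix g assume g: "g \<in> carrier G"
    have "sqnorm f = (\<Sum>v\<in>V. (f v)\<^sup>2)" using V by (intro gsum_eq_sum) auto
    then show "((markov ^^ n) f g)\<^sup>2 \<le> sqnorm f * (\<Sum>v\<in>V. (?p (inv v \<otimes> g))\<^sup>2)"
      using Cauchy_Schwarz_ineq_sum[of f "\<lambda>v. ?p (inv v \<otimes> g)" V] markov_power_convolution[where f = f and n = n, OF V g] by simp
  qed
  also have "\<dots> = sqnorm f * (\<Sum>v\<in>V. sqnorm (\<lambda>g. ?p (inv v \<otimes> g)))"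
    using V(1) by (simp only: gsum_cmult gsum_sum fin_supp_power2 fst)
  also have "\<dots> = card V * sqnorm f * pmf (conv_power G \<mu> (2 * n)) \<one>"
    by (simp add: tr sqnorm_markov_power_delta)
  finally show ?thesis .
qed

lemma return_probability_ge:
  assumes V: "finite V" "V \<subseteq> carrier G" "\<And>g. g \<in> carrier G \<Longrightarrow> g \<notin> V \<Longrightarrow> f g = 0"
    and "\<And>h. h \<in> set_pmf \<mu> \<Longrightarrow> displacement f h \<le> 2 * e * sqnorm f" "e \<le> 1" "sqnorm f > 0"
  shows "pmf (conv_power G \<mu> (2 * n)) \<one> \<ge> (1 - e) ^ (2 * n) / card V"
proof -
  have fs: "fin_supp f" using V by (intro fin_suppI)
  have "V \<noteq> {}"
  proof
    assume "V = {}"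
    then have "sqnorm f = 0" using gsum_eq_sum[of V "\<lambda>g. (f g)\<^sup>2"] V by simp
    then show False using assms by simp
  qed
  then have "card V > 0" using V by (simp add: card_gt_0_iff)
  moreover have "(1 - e) ^ (2 * n) * sqnorm f \<le> (card V * pmf (conv_power G \<mu> (2 * n)) \<one>) * sqnorm f"
    using sqnorm_markov_power_ge[OF fs assms(4-6), of n] sqnorm_markov_power_le[where f = f and n = n, OF V]
    by (simp add: mult_ac)
  ultimately show ?thesis using assms(6) by (simp add: divide_le_eq mult.commute)
qed

end

section \<open>Isoperimetry\<close>

text \<open>Layer-cake decomposition: subtract from \<open>p\<close> its least value
  \<open>m\<close> on its support \<open>U\<close>. The double sum drops by exactly \<open>m\<close>
  times the boundary count of \<open>U\<close>, the left side by \<open>m * card U\<close>, and the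
  support shrinks, so induction on its size applies.\<close>

lemma coarea:
  fixes c :: real
  assumes V: "finite V" and T: "finite T"
    and iso: "\<And>U. U \<subseteq> V \<Longrightarrow> U \<noteq> {} \<Longrightarrow> real (card U) \<le> c * (\<Sum>t\<in>T. card {g \<in> U. g \<otimes> t \<notin> U})"
    and p: "\<And>g. 0 \<le> p g" "\<And>g. g \<notin> V \<Longrightarrow> p g = 0"
  shows "sum p V \<le> c * (\<Sum>t\<in>T. \<Sum>g\<in>V. max 0 (p g - p (g \<otimes> t)))"
  using p
proof (induction "card {g. p g \<noteq> 0}" arbitrary: p rule: less_induct)
  case less
  define U where "U = {g. p g \<noteq> 0}"
  have UV: "U \<subseteq> V" unfolding U_def using less(3) by force
  then have finU: "finite U" using V finite_subset by blast
  show ?case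
  proof (cases "U = {}")
    case True
    then show ?thesis by (simp add: U_def)
  next
    case False
    define m where "m = Min (p ` U)"
    have m: "m > 0" "\<And>g. g \<in> U \<Longrightarrow> m \<le> p g"
      using finU False less(2) by (auto simp: m_def U_def Min_gr_iff order.not_eq_order_implies_strict)
    have "m \<in> p ` U" unfolding m_def using finU False by (intro Min_in) auto
    then obtain g0 where g0: "g0 \<in> U" "p g0 = m" by auto
    define r where "r g = p g - (if g \<in> U then m else 0)" for g
    have r: "0 \<le> r g" "g \<notin> V \<Longrightarrow> r g = 0" for g
      using m(2)[of g] less(2,3)[of g] UV by (auto simp: r_def)
    have "{g. r g \<noteq> 0} \<subset> U"
      using g0 by (auto simp: r_def U_def)
    then have IH: "sum r V \<le> c * (\<Sum>t\<in>T. \<Sum>g\<in>V. max 0 (r g - r (g \<otimes> t)))"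
      using r finU by (intro less(1)) (auto simp: U_def intro: psubset_card_mono)
    have "sum p V = sum r V + (\<Sum>g\<in>V. if g \<in> U then m else 0)"
      unfolding sum.distrib[symmetric] by (intro sum.cong) (auto simp: r_def)
    also have "(\<Sum>g\<in>V. if g \<in> U then m else 0) = m * card U"
      using UV V by (simp add: sum.If_cases Int_absorb1)
    also have "m * card U \<le> m * (c * (\<Sum>t\<in>T. card {g \<in> U. g \<otimes> t \<notin> U}))"
      using m iso[OF UV False] by (intro mult_left_mono) auto
    also have "\<dots> = c * (\<Sum>t\<in>T. \<Sum>g\<in>V. if g \<in> U \<and> g \<otimes> t \<notin> U then m else 0)"
    proof -
      have "(\<Sum>g\<in>V. if g \<in> U \<and> g \<otimes> t \<notin> U then m else 0) = m * card {g \<in> U. g \<otimes> t \<notin> U}" for t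
      proof -
        have "V \<inter> {g. g \<in> U \<and> g \<otimes> t \<notin> U} = {g \<in> U. g \<otimes> t \<notin> U}" using UV by auto
        then show ?thesis using V by (simp add: sum.If_cases)
      qed
      then show ?thesis by (simp add: sum_distrib_left mult_ac)
    qed
    finally have "sum p V \<le> c * (\<Sum>t\<in>T. \<Sum>g\<in>V. max 0 (r g - r (g \<otimes> t)) + (if g \<in> U \<and> g \<otimes> t \<notin> U then m else 0))"
      using IH by (simp add: sum.distrib distrib_left)
    also have "(\<Sum>t\<in>T. \<Sum>g\<in>V. max 0 (r g - r (g \<otimes> t)) + (if g \<in> U \<and> g \<otimes> t \<notin> U then m else 0)) =
        (\<Sum>t\<in>T. \<Sum>g\<in>V. max 0 (p g - p (g \<otimes> t)))"
    proof (intro sum.cong refl)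
      fix t g
      have "p h = 0" if "h \<notin> U" for h using that by (simp add: U_def)
      then show "max 0 (r g - r (g \<otimes> t)) + (if g \<in> U \<and> g \<otimes> t \<notin> U then m else 0) = max 0 (p g - p (g \<otimes> t))"
        using m(2)[of g] less(2)[of "g \<otimes> t"] m(2)[of "g \<otimes> t"] m(1) by (auto simp: r_def max_def)
    qed
    finally show ?thesis .
  qed
qed

text \<open>The difference of squares factors, and Cauchy-Schwarz applies; the factor with the sum
  has squared norm at most \<open>4 * sqnorm f\<close>.\<close>

lemma gsum_square_difference:
  assumes "x \<in> carrier G" "fin_supp f"
  shows "gsum (\<lambda>g. \<bar>(f g)\<^sup>2 - (f (g \<otimes> x))\<^sup>2\<bar>) \<le> 2 * sqrt (displacement f x * sqnorm f)"
proof -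
  note fx = fin_supp_translate[OF assms]
  have abs: "fin_supp (\<lambda>g. \<bar>h g\<bar>)" if "fin_supp h" for h using that by (simp add: fin_supp_def)
  have fs1: "fin_supp (\<lambda>g. \<bar>f (g \<otimes> x) - f g\<bar>)" and fs2: "fin_supp (\<lambda>g. \<bar>f (g \<otimes> x) + f g\<bar>)"
    using assms fx by (auto intro: abs fin_supp_add fin_supp_diff)
  have "sqnorm (\<lambda>g. \<bar>f (g \<otimes> x) + f g\<bar>) \<le> gsum (\<lambda>g. 2 * (f (g \<otimes> x))\<^sup>2 + 2 * (f g)\<^sup>2)"
    using square_add_le assms fx fs2 by (intro gsum_mono) (auto intro!: fin_supp_power2 fin_supp_add fin_supp_cmult)
  also have "\<dots> = 2 * sqnorm (\<lambda>g. f (g \<otimes> x)) + 2 * sqnorm f"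
    using assms fx by (simp add: gsum_add gsum_cmult fin_supp_cmult fin_supp_power2)
  also have "sqnorm (\<lambda>g. f (g \<otimes> x)) = sqnorm f"
    by (rule gsum_translate[OF assms(1), of "\<lambda>g. (f g)\<^sup>2"])
  finally have 1: "sqnorm (\<lambda>g. \<bar>f (g \<otimes> x) + f g\<bar>) \<le> 4 * sqnorm f" by simp
  have "gsum (\<lambda>g. \<bar>(f g)\<^sup>2 - (f (g \<otimes> x))\<^sup>2\<bar>) = gsum (\<lambda>g. \<bar>f (g \<otimes> x) - f g\<bar> * \<bar>f (g \<otimes> x) + f g\<bar>)"
    by (intro gsum_cong) (simp add: abs_mult[symmetric] power2_eq_square algebra_simps abs_minus_commute)
  also have "\<dots> \<le> sqrt (displacement f x * (4 * sqnorm f))"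
  proof (rule real_le_rsqrt)
    have "(gsum (\<lambda>g. \<bar>f (g \<otimes> x) - f g\<bar> * \<bar>f (g \<otimes> x) + f g\<bar>))\<^sup>2 \<le>
        sqnorm (\<lambda>g. \<bar>f (g \<otimes> x) - f g\<bar>) * sqnorm (\<lambda>g. \<bar>f (g \<otimes> x) + f g\<bar>)"
      by (rule gsum_Cauchy_Schwarz[OF fs1 fs2])
    also have "\<dots> \<le> displacement f x * (4 * sqnorm f)"
      using mult_left_mono[OF 1 displacement_nonneg[of f x]] by simp
    finally show "(gsum (\<lambda>g. \<bar>f (g \<otimes> x) - f g\<bar> * \<bar>f (g \<otimes> x) + f g\<bar>))\<^sup>2 \<le> displacement f x * (4 * sqnorm f)" .
  qed
  also have "\<dots> = 2 * sqrt (displacement f x * sqnorm f)" by (simp add: real_sqrt_mult)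
  finally show ?thesis .
qed

text \<open>Adjacency runs along a generator in either direction, so the inverses enter
  \<open>T\<close>.\<close>

lemma inner_boundary_cayley_le:
  assumes S: "finite S" "S \<subseteq> carrier G" and U: "finite U" "U \<subseteq> carrier G"
  defines "T \<equiv> S \<union> m_inv G ` S"
  shows "card (inner_boundary (carrier G) (cayley_adj G S) U) \<le> (\<Sum>t\<in>T. card {g \<in> U. g \<otimes> t \<notin> U})"
proof -
  have T: "finite T" using S by (simp add: T_def)
  have "inner_boundary (carrier G) (cayley_adj G S) U \<subseteq> (\<Union>t\<in>T. {g \<in> U. g \<otimes> t \<notin> U})"
  proof
    fix v assume "v \<in> inner_boundary (carrier G) (cayley_adj G S) U"
    then obtain w s where v: "v \<in> U" and w: "w \<in> carrier G" "w \<notin> U"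
      and s: "s \<in> S" and "w = v \<otimes> s \<or> v = w \<otimes> s"
      by (auto simp: inner_boundary_def cayley_adj_def)
    then consider "w = v \<otimes> s" | "v = w \<otimes> s" by blast
    then show "v \<in> (\<Union>t\<in>T. {g \<in> U. g \<otimes> t \<notin> U})"
    proof cases
      case 1
      then have "s \<in> T" "v \<otimes> s \<notin> U" using w s by (auto simp: T_def)
      then show ?thesis using v by blast
    next
      case 2
      then have "v \<otimes> inv s = w" using w s S by (auto simp: m_assoc subset_iff)
      then have "inv s \<in> T" "v \<otimes> inv s \<notin> U" using w s by (auto simp: T_def)
      then show ?thesis using v by blast
    qed
  qed
  then have "card (inner_boundary (carrier G) (cayley_adj G S) U) \<le> card (\<Union>t\<in>T. {g \<in> U. g \<otimes> t \<notin> U})"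
    using T U by (intro card_mono) auto
  also have "\<dots> \<le> (\<Sum>t\<in>T. card {g \<in> U. g \<otimes> t \<notin> U})" using T by (rule card_UN_le)
  finally show ?thesis .
qed

text \<open>Cheeger's argument: if every nonempty subset of \<open>V\<close> had a large boundary,
  the coarea inequality for the square of \<open>f\<close> would give
  \<open>sqnorm f \<le> 4 * n * card S * sqrt e * sqnorm f\<close>. One factor 2 comes from the
  difference of squares, the other from the inverses in \<open>T\<close>.\<close>

lemma isoperimetric_profile_le:
  assumes V: "finite V" "V \<subseteq> carrier G" "\<And>g. g \<notin> V \<Longrightarrow> f g = 0" and pos: "sqnorm f > 0"
    and S: "finite S" "S \<subseteq> carrier G" "\<And>s. s \<in> S \<Longrightarrow> displacement f s \<le> e * sqnorm f"
    and small: "4 * n * card S * sqrt e < 1"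
  shows "isoperimetric_profile (carrier G) (cayley_adj G S) n \<le> of_nat (card V)"
proof -
  define T where "T = S \<union> m_inv G ` S"
  have T: "finite T" "T \<subseteq> carrier G" using S by (auto simp: T_def)
  have cardT: "card T \<le> 2 * card S"
    using card_Un_le[of S "m_inv G ` S"] card_image_le[OF S(1), of "m_inv G"] by (simp add: T_def)
  have fs: "fin_supp f" using V by (intro fin_suppI)
  have disp: "displacement f t \<le> e * sqnorm f" if "t \<in> T" for t
    using that S(2,3) by (auto simp: T_def displacement_inv subset_iff)
  have "\<exists>U\<subseteq>V. U \<noteq> {} \<and> n * (\<Sum>t\<in>T. card {g \<in> U. g \<otimes> t \<notin> U}) \<le> card U"
  proof (rule ccontr)
    assume neg: "\<not> ?thesis"
    have "real (card U) \<le> real n * (\<Sum>t\<in>T. card {g \<in> U. g \<otimes> t \<notin> U})" if "U \<subseteq> V" "U \<noteq> {}" for U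
    proof -
      have "\<not> n * (\<Sum>t\<in>T. card {g \<in> U. g \<otimes> t \<notin> U}) \<le> card U" using neg that by blast
      then have "card U \<le> n * (\<Sum>t\<in>T. card {g \<in> U. g \<otimes> t \<notin> U})" by simp
      then have "real (card U) \<le> real (n * (\<Sum>t\<in>T. card {g \<in> U. g \<otimes> t \<notin> U}))"
        by (rule of_nat_mono)
      then show ?thesis by simp
    qed
    from coarea[OF V(1) T(1) this, of "\<lambda>g. (f g)\<^sup>2"] V(3)
    have coarea_f: "(\<Sum>g\<in>V. (f g)\<^sup>2) \<le> real n * (\<Sum>t\<in>T. \<Sum>g\<in>V. max 0 ((f g)\<^sup>2 - (f (g \<otimes> t))\<^sup>2))" by simp
    have sq: "(\<Sum>g\<in>V. (f g)\<^sup>2) = sqnorm f" using V by (intro gsum_eq_sum[symmetric]) auto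
    have "(\<Sum>t\<in>T. \<Sum>g\<in>V. max 0 ((f g)\<^sup>2 - (f (g \<otimes> t))\<^sup>2)) \<le> (\<Sum>t\<in>T. 2 * sqrt e * sqnorm f)"
    proof (rule sum_mono)
      fix t assume t: "t \<in> T"
      then have tc: "t \<in> carrier G" using T by auto
      have "(\<Sum>g\<in>V. max 0 ((f g)\<^sup>2 - (f (g \<otimes> t))\<^sup>2)) = gsum (\<lambda>g. max 0 ((f g)\<^sup>2 - (f (g \<otimes> t))\<^sup>2))"
        using V by (intro gsum_eq_sum[symmetric]) (auto simp: max_def)
      also have "\<dots> \<le> gsum (\<lambda>g. \<bar>(f g)\<^sup>2 - (f (g \<otimes> t))\<^sup>2\<bar>)"
      proof (rule gsum_mono)
        show "fin_supp (\<lambda>g. max 0 ((f g)\<^sup>2 - (f (g \<otimes> t))\<^sup>2))"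
          using V by (intro fin_suppI[of V]) (auto simp: max_def)
        show "fin_supp (\<lambda>g. \<bar>(f g)\<^sup>2 - (f (g \<otimes> t))\<^sup>2\<bar>)"
          using fin_supp_diff[OF fin_supp_power2[OF fs] fin_supp_power2[OF fin_supp_translate[OF tc fs]]]
          by (simp add: fin_supp_def)
      qed auto
      also have "\<dots> \<le> 2 * sqrt (displacement f t * sqnorm f)" by (rule gsum_square_difference[OF tc fs])
      also have "\<dots> \<le> 2 * sqrt (e * sqnorm f * sqnorm f)"
        using disp[OF t] pos by (simp add: mult_right_mono)
      also have "\<dots> = 2 * sqrt e * sqnorm f" using pos by (simp add: real_sqrt_mult mult.assoc)
      finally show "(\<Sum>g\<in>V. max 0 ((f g)\<^sup>2 - (f (g \<otimes> t))\<^sup>2)) \<le> 2 * sqrt e * sqnorm f" .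
    qed
    from mult_left_mono[OF this, of "real n"] coarea_f
    have "1 * sqnorm f \<le> (real n * (card T * (2 * sqrt e))) * sqnorm f"
      by (simp add: sq mult_ac)
    then have "1 \<le> real n * (card T * (2 * sqrt e))" using pos by (simp only: mult_le_cancel_right_pos)
    \<comment> \<open>For nonempty \<open>T\<close> the displacement bound forces
      \<open>e \<ge> 0\<close>; for empty \<open>T\<close> both sides vanish.\<close>
    moreover have "real n * (card T * (2 * sqrt e)) \<le> real n * ((2 * card S) * (2 * sqrt e))"
    proof (cases "T = {}")
      case False
      then obtain t where "t \<in> T" by auto
      then have "0 \<le> e * sqnorm f" using disp displacement_nonneg order_trans by blast
      then have "e \<ge> 0" using pos by (simp add: zero_le_mult_iff)
      then show ?thesis using cardT by (intro mult_left_mono mult_right_mono) auto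
    qed (simp add: T_def)
    ultimately show False using small by (simp add: mult_ac)
  qed
  then obtain U where U: "U \<subseteq> V" "U \<noteq> {}" "n * (\<Sum>t\<in>T. card {g \<in> U. g \<otimes> t \<notin> U}) \<le> card U" by blast
  have fU: "finite U" "U \<subseteq> carrier G" using U(1) V(1,2) by (auto intro: finite_subset)
  have "n * card (inner_boundary (carrier G) (cayley_adj G S) U) \<le> n * (\<Sum>t\<in>T. card {g \<in> U. g \<otimes> t \<notin> U})"
    using inner_boundary_cayley_le[OF S(1,2) fU] by (simp add: T_def)
  with U have "n * card (inner_boundary (carrier G) (cayley_adj G S) U) \<le> card U" by linarith
  then have "isoperimetric_profile (carrier G) (cayley_adj G S) n \<le> of_nat (card U)"
    unfolding isoperimetric_profile_def using U fU by (intro INF_lower) auto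
  also have "\<dots> \<le> of_nat (card V)" using U V by (simp add: card_mono)
  finally show ?thesis .
qed

end

section \<open>Test functions on the Mother group\<close>

lemma mother_group_simps:
  "monoid.mult (mother_group z) = (\<lambda>f g. g \<circ> f)" "one (mother_group z) = id"
  "carrier (mother_group z) = generate tree_aut_group (mother_gens z)"
  by (simp_all add: mother_group_def tree_aut_group_def)

lemma generate_mother_gens: "generate (mother_group z) (mother_gens z) = carrier (mother_group (z::'a::finite))"
  and mother_gens_carrier: "mother_gens z \<subseteq> carrier (mother_group z)"
  using mother_gens_generate[of z] by (auto simp: finite_generating_set_def)

lemma act_mother_gens: "c \<in> letters z \<Longrightarrow> act z c \<in> mother_gens z"
  by (auto simp: letters_def mother_gens_def)

lemma eval_word_carrier:
  fixes z :: "'a::finite"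
  assumes "set w \<subseteq> letters z" shows "eval_word z w \<in> carrier (mother_group z)"
  using assms
proof (induction w)
  interpret M: group "mother_group z" by (rule group_mother_group)
  case Nil
  then show ?case using M.one_closed by (simp only: eval_word.simps mother_group_simps(2))
next
  interpret M: group "mother_group z" by (rule group_mother_group)
  case (Cons c w)
  have "act z c \<in> carrier (mother_group z)" using Cons.prems act_mother_gens[of c z] mother_gens_carrier by auto
  then have "act z c \<otimes>\<^bsub>mother_group z\<^esub> eval_word z w \<in> carrier (mother_group z)"
    using Cons by (intro M.m_closed) auto
  then show ?case by (simp only: eval_word.simps mother_group_simps(1))
qed

lemma small_elements_carrier: "small_elements z m \<subseteq> carrier (mother_group (z::'a::finite))"
  by (auto simp: small_elements_def eval_word_carrier)

section \<open>The random walk with steps in \<open>A B A\<close>\<close>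

definition steps :: "'a::finite \<Rightarrow> (('a \<Rightarrow> 'a) \<times> (('a \<Rightarrow> 'a \<Rightarrow> 'a) \<times> ('a \<Rightarrow> 'a)) \<times> ('a \<Rightarrow> 'a)) set" where
  "steps z = perms \<times> carrier (wreath z) \<times> perms"

fun step_word :: "('a \<Rightarrow> 'a) \<times> (('a \<Rightarrow> 'a \<Rightarrow> 'a) \<times> ('a \<Rightarrow> 'a)) \<times> ('a \<Rightarrow> 'a) \<Rightarrow> 'a letter list" where
  "step_word (a, p, b) = [Rt a, Dr p, Rt b]"

text \<open>New steps are appended on the right, matching the recursion of
  \<open>killed_walk\<close>.\<close>

fun walk_pattern :: "nat \<Rightarrow> bool list" where
  "walk_pattern 0 = []"
| "walk_pattern (Suc n) = walk_pattern n @ [False, True, False]"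

lemma changes_le_length: "changes s \<le> length s"
  by (induction s rule: changes.induct) auto

lemma length_walk_pattern: "length (walk_pattern n) = 3 * n"
  by (induction n) auto

lemma finite_steps: "finite (steps z)" "steps z \<noteq> {}"
  using finite_perms finite_wreath[of z] by (auto simp: steps_def simp del: mem_Collect_eq)

lemma step_word_letters: "i \<in> steps z \<Longrightarrow> set (step_word i) \<subseteq> letters z"
  by (auto simp: steps_def)

lemma word_mean_average:
  "word_mean z s (\<lambda>w. average S (\<lambda>i. f i w)) = average S (\<lambda>i. word_mean z s (f i))"
proof (induction s arbitrary: f)
  case (Cons t s)
  then show ?case by (cases t) (auto intro: average_swap)
qed auto

lemma word_mean_walk_pattern_Suc:
  "word_mean z (walk_pattern (Suc n)) f =
    average (steps z) (\<lambda>i. word_mean z (walk_pattern n) (\<lambda>v. f (v @ step_word i)))"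
proof -
  have "word_mean z (walk_pattern (Suc n)) f =
      word_mean z (walk_pattern n) (\<lambda>v. average (steps z) (\<lambda>i. f (v @ step_word i)))"
    by (simp add: word_mean_append steps_def average_Times)
  then show ?thesis by (simp add: word_mean_average)
qed

context
  fixes z :: "'a::finite"
begin

interpretation M: group "mother_group z" by (rule group_mother_group)

lemma eval_step_carrier: "i \<in> steps z \<Longrightarrow> eval_word z (step_word i) \<in> carrier (mother_group z)"
  by (intro eval_word_carrier step_word_letters)

lemmas killed_facts = finite_steps[of z] eval_step_carrier small_elements_card(1) small_elements_carrier

abbreviation killed :: "nat \<Rightarrow> nat \<Rightarrow> ('a list \<Rightarrow> 'a list) \<Rightarrow> real" where
  "killed m \<equiv> M.killed_walk (steps z) (\<lambda>i. eval_word z (step_word i)) (small_elements z m)"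

text \<open>As portrait sizes do not decrease along a word, a word of small portrait size describes a
  trajectory which is never killed.\<close>

lemma killed_walk_ge:
  "word_mean z (walk_pattern n) (\<lambda>w. if eval_word z w = g \<and> portrait_size z w \<le> m then 1 else 0) \<le> killed m n g"
proof (induction n arbitrary: g)
  case 0
  show ?case using M.killed_walk.simps(1) by (auto simp: mother_group_simps)
next
  case (Suc n)
  show ?case
  proof (cases "g \<in> small_elements z m")
    case False
    have "word_mean z (walk_pattern (Suc n)) (\<lambda>w. if eval_word z w = g \<and> portrait_size z w \<le> m then 1 else 0)
        \<le> word_mean z (walk_pattern (Suc n)) (\<lambda>w. 0)"
      using False by (intro word_mean_mono) (auto simp: small_elements_def)
    then show ?thesis using M.killed_walk.simps(2) False by (simp add: word_mean_const)
  next
    case True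
    let ?s = "\<lambda>i. eval_word z (step_word i)"
    have "word_mean z (walk_pattern (Suc n)) (\<lambda>w. if eval_word z w = g \<and> portrait_size z w \<le> m then 1 else 0) \<le>
        average (steps z) (\<lambda>i. killed m n (g \<otimes>\<^bsub>mother_group z\<^esub> inv\<^bsub>mother_group z\<^esub> ?s i))"
      unfolding word_mean_walk_pattern_Suc
    proof (intro average_mono order_trans[OF word_mean_mono Suc.IH])
      fix i v assume i: "i \<in> steps z" and v: "set v \<subseteq> letters z"
      have "eval_word z v = g \<otimes>\<^bsub>mother_group z\<^esub> inv\<^bsub>mother_group z\<^esub> ?s i" if "eval_word z (v @ step_word i) = g"
      proof -
        have "g = eval_word z v \<otimes>\<^bsub>mother_group z\<^esub> ?s i"
          using that by (simp add: eval_word_append mother_group_simps)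
        then show ?thesis using eval_word_carrier[OF v] eval_step_carrier[OF i] by (simp add: M.m_assoc)
      qed
      moreover have "portrait_size z v \<le> portrait_size z (v @ step_word i)" by (rule portrait_size_append)
      ultimately show "(if eval_word z (v @ step_word i) = g \<and> portrait_size z (v @ step_word i) \<le> m then 1 else 0)
          \<le> (if eval_word z v = g \<otimes>\<^bsub>mother_group z\<^esub> inv\<^bsub>mother_group z\<^esub> ?s i \<and> portrait_size z v \<le> m then 1 else 0 :: real)"
        by auto
    qed
    then show ?thesis using M.killed_walk.simps(2) True by simp
  qed
qed

text \<open>Markov's inequality, in the form that \<open>1 - portrait_size z w / m\<close> is at
  most the indicator of portrait size at most \<open>m\<close>.\<close>

lemma killed_walk_mass:
  assumes "2 * word_mean z (walk_pattern n) (\<lambda>w. real (portrait_size z w)) \<le> real m" "m > 0"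
  shows "sum (killed m n) (small_elements z m) \<ge> 1 / 2"
proof -
  let ?E = "word_mean z (walk_pattern n)"
  let ?V = "small_elements z m"
  have "1 / 2 \<le> (- 1 / m) * ?E (\<lambda>w. real (portrait_size z w)) + 1"
    using assms by (simp add: field_simps)
  also have "\<dots> = ?E (\<lambda>w. (- 1 / m) * real (portrait_size z w) + 1)"
    by (rule word_mean_affine[symmetric])
  also have "\<dots> \<le> ?E (\<lambda>w. \<Sum>g\<in>?V. if eval_word z w = g \<and> portrait_size z w \<le> m then 1 else 0)"
  proof (rule word_mean_mono)
    fix w assume w: "set w \<subseteq> letters z"
    show "(- 1 / m) * real (portrait_size z w) + 1 \<le> (\<Sum>g\<in>?V. if eval_word z w = g \<and> portrait_size z w \<le> m then 1 else 0)"
    proof (cases "portrait_size z w \<le> m")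
      case True
      then have "eval_word z w \<in> ?V" using w by (auto simp: small_elements_def)
      then have "(\<Sum>g\<in>?V. if eval_word z w = g \<and> portrait_size z w \<le> m then 1 else 0 :: real) = 1"
        using True small_elements_card(1)[of z m] by simp
      then show ?thesis by simp
    next
      case False
      then show ?thesis using assms(2) by (simp add: field_simps)
    qed
  qed
  also have "\<dots> = (\<Sum>g\<in>?V. ?E (\<lambda>w. if eval_word z w = g \<and> portrait_size z w \<le> m then 1 else 0))"
    by (rule word_mean_sum)
  also have "\<dots> \<le> sum (killed m n) ?V" by (intro sum_mono killed_walk_ge)
  finally show ?thesis .
qed

text \<open>Identity letters fill up the step, so displacement bounds for steps cover all
  generators.\<close>

lemma mother_gens_steps:
  assumes "g \<in> mother_gens z" shows "\<exists>i\<in>steps z. g = eval_word z (step_word i)"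
proof -
  let ?e = "\<one>\<^bsub>wreath z\<^esub>"
  have e: "?e \<in> carrier (wreath z)" by (auto simp: wreath_def permutes_id)
  have e_id: "directed z ?e = id" and r_id: "rooted (id :: 'a \<Rightarrow> 'a) = id" using directed_one rooted_id by (auto simp: fun_eq_iff)
  from assms consider a where "a permutes UNIV" "g = rooted a" | p where "p \<in> carrier (wreath z)" "g = directed z p"
    by (auto simp: mother_gens_def)
  then show ?thesis
  proof cases
    case 1
    then show ?thesis using e e_id r_id by (intro bexI[of _ "(a, ?e, id)"]) (auto simp: steps_def permutes_id)
  next
    case 2
    then show ?thesis using r_id by (intro bexI[of _ "(id, p, id)"]) (auto simp: steps_def permutes_id)
  qed
qed

text \<open>The walk of length \<open>n\<close> is killed outside \<open>small_elements z m\<close>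
  with \<open>m\<close> about twice the expected portrait size. Then \<open>ln (card V)\<close> is
  at most linear in \<open>m\<close>, hence of order at most \<open>n powr b\<close>, and division
  by \<open>n\<close> gives the displacement.\<close>

lemma test_functions:
  fixes b :: real
  assumes d: "CARD('a) \<ge> 2" and b: "0 < b" "b < 1"
    and contr: "CARD('a) * ((real CARD('a) - 1) / real CARD('a) ^ 2) powr b < 1"
  shows "\<exists>C>0. \<forall>n\<ge>1. \<exists>V f. finite V \<and> V \<subseteq> carrier (mother_group z) \<and> V \<noteq> {} \<and>
    (\<forall>g. g \<notin> V \<longrightarrow> f g = 0) \<and> M.sqnorm f > 0 \<and> ln (card V) \<le> C * real n powr b \<and>
    (\<forall>s\<in>mother_gens z. M.displacement f s \<le> C * real n powr (b - 1) * M.sqnorm f)"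
proof -
  obtain C1 where C1: "C1 > 0"
      "\<And>s. word_mean z s (\<lambda>w. real (portrait_size z w)) \<le> C1 * (real (changes s) + 1) powr b"
    using word_mean_portrait_size[OF d b contr, of z] by blast
  define K where "K = real (card (symbols z) + 1)"
  define C2 where "C2 = ln 4 + (2 * C1 * 4 powr b + 3) * ln K"
  define J where "J = 2 * (real (card (steps z)))\<^sup>2"
  have K: "K \<ge> 1" by (simp add: K_def)
  have C2: "C2 > 0" unfolding C2_def using C1 K by (intro add_pos_nonneg mult_nonneg_nonneg) auto
  have J: "J \<ge> 0" by (simp add: J_def)
  have "\<exists>V f. finite V \<and> V \<subseteq> carrier (mother_group z) \<and> V \<noteq> {} \<and>
      (\<forall>g. g \<notin> V \<longrightarrow> f g = 0) \<and> M.sqnorm f > 0 \<and> ln (card V) \<le> (J + 1) * C2 * real n powr b \<and>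
      (\<forall>s\<in>mother_gens z. M.displacement f s \<le> (J + 1) * C2 * real n powr (b - 1) * M.sqnorm f)" if n: "n \<ge> 1" for n
  proof -
    define E where "E = word_mean z (walk_pattern n) (\<lambda>w. real (portrait_size z w))"
    \<comment> \<open>Twice the mean serves Markov's inequality; the added 1 makes \<open>m\<close>
      positive, so the identity, with portrait size 1, belongs to the set.\<close>
    define m where "m = nat \<lceil>2 * E\<rceil> + 1"
    have nb: "real n powr b \<ge> 1" using n b by (intro ge_one_powr_ge_zero) auto
    have "E \<le> C1 * (real (changes (walk_pattern n)) + 1) powr b" unfolding E_def by (rule C1)
    \<comment> \<open>There are at most \<open>3 * n\<close> changes, and
      \<open>3 * n + 1 \<le> 4 * n\<close>.\<close>
    also have "\<dots> \<le> C1 * (4 * real n) powr b"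
      using C1(1) b n changes_le_length[of "walk_pattern n"] length_walk_pattern[of n]
      by (intro mult_left_mono powr_mono2) auto
    also have "\<dots> = C1 * 4 powr b * real n powr b" by (simp add: powr_mult)
    finally have E: "E \<le> C1 * 4 powr b * real n powr b" .
    have "E \<ge> word_mean z (walk_pattern n) (\<lambda>w. 0)" unfolding E_def by (intro word_mean_mono) auto
    then have E0: "E \<ge> 0" by (simp add: word_mean_const)
    have m: "2 * E \<le> real m" "m > 0" "real m \<le> 2 * E + 2" unfolding m_def using E0 by linarith+
    let ?V = "small_elements z m"
    have one: "\<one>\<^bsub>mother_group z\<^esub> \<in> ?V"
      unfolding small_elements_def using m(2)
      by (intro image_eqI[of _ _ "[]"]) (auto simp: mother_group_simps portrait_size.simps[of z "[]"])
    then have cV: "card ?V > 0" using small_elements_card(1)[of z m] by (auto simp: card_gt_0_iff)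
    have "real (card ?V) \<le> K ^ (m + 1)"
      using small_elements_card(2)[of z m] unfolding K_def by (metis of_nat_le_iff of_nat_power)
    then have "ln (card ?V) \<le> ln (K ^ (m + 1))" using cV K by simp
    also have "\<dots> = (real m + 1) * ln K" using K by (subst ln_realpow) auto
    finally have "ln (4 * card ?V) \<le> ln 4 + (real m + 1) * ln K" using cV by (simp add: ln_mult)
    also have "\<dots> \<le> ln 4 * real n powr b + ((2 * C1 * 4 powr b + 3) * real n powr b) * ln K"
    proof (intro add_mono mult_right_mono)
      show "ln 4 \<le> ln 4 * real n powr b" using nb by simp
      have "real m + 1 \<le> 2 * (C1 * 4 powr b * real n powr b) + 3 * real n powr b" using m E nb by linarith
      then show "real m + 1 \<le> (2 * C1 * 4 powr b + 3) * real n powr b" by (simp add: algebra_simps)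
    qed (use K in simp)
    also have "\<dots> = C2 * real n powr b" by (simp add: C2_def algebra_simps)
    finally have lnV: "ln (4 * card ?V) \<le> C2 * real n powr b" .
    obtain i0 where i0: "i0 \<in> steps z" "eval_word z (step_word i0) = \<one>\<^bsub>mother_group z\<^esub>"
    proof -
      have "rooted id \<in> mother_gens z" by (auto simp: mother_gens_def permutes_id)
      moreover have "rooted (id :: 'a \<Rightarrow> 'a) = id" by (simp add: fun_eq_iff rooted_id)
      ultimately show ?thesis using that mother_gens_steps[of id] by (auto simp: mother_group_simps)
    qed
    obtain f where f: "\<And>g. g \<notin> ?V \<Longrightarrow> f g = 0" "M.sqnorm f > 0"
        "\<And>i. i \<in> steps z \<Longrightarrow> M.displacement f (eval_word z (step_word i)) \<le> J * (ln (4 * card ?V) / n) * M.sqnorm f"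
      using M.killed_walk_almost_invariant[OF killed_facts n one killed_walk_mass[OF m(1)[unfolded E_def] m(2)] i0]
      unfolding J_def by blast
    have "ln (card ?V) \<le> ln (4 * card ?V)" using cV by simp
    then have "ln (card ?V) \<le> 1 * (C2 * real n powr b)" using lnV by simp
    also have "\<dots> \<le> (J + 1) * (C2 * real n powr b)" using J C2 by (intro mult_right_mono) auto
    finally have 1: "ln (card ?V) \<le> (J + 1) * C2 * real n powr b" by simp
    have "C2 * real n powr b / n = C2 * real n powr (b - 1)" using n by (simp add: powr_diff)
    then have "ln (4 * card ?V) / n \<le> C2 * real n powr (b - 1)"
      using divide_right_mono[OF lnV, of "real n"] by simp
    then have "J * (ln (4 * card ?V) / n) \<le> J * (C2 * real n powr (b - 1))" using J by (intro mult_left_mono)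
    also have "\<dots> \<le> (J + 1) * C2 * real n powr (b - 1)" using C2 by (simp add: algebra_simps)
    finally have 2: "J * (ln (4 * card ?V) / n) * M.sqnorm f \<le> (J + 1) * C2 * real n powr (b - 1) * M.sqnorm f"
      using f(2) by (intro mult_right_mono) auto
    have 3: "M.displacement f s \<le> (J + 1) * C2 * real n powr (b - 1) * M.sqnorm f" if "s \<in> mother_gens z" for s
      using mother_gens_steps[OF that] f(3) 2 order_trans by blast
    show ?thesis
      using f(1,2) 1 3 one small_elements_card(1)[of z m] small_elements_carrier[of z m]
      by (intro exI[of _ ?V] exI[of _ f]) blast
  qed
  then show ?thesis using C2 J by (intro exI[of _ "(J + 1) * C2"]) auto
qed

end

section \<open>Asymptotics\<close>

text \<open>The larger exponent absorbs the factor and the shift up to an additive constant, which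
  turns into the multiplicative constant of the comparison after exponentiation.\<close>

lemma powr_shift_le:
  fixes D m b c :: real
  assumes "0 \<le> D" "0 \<le> m" "0 < b" "b < c"
  shows "\<exists>K. \<forall>t\<ge>0. D * (t + m) powr b \<le> t powr c + K"
proof -
  have "((\<lambda>t. D * 2 powr b * t powr (b - c)) \<longlongrightarrow> D * 2 powr b * 0) at_top"
    using assms by (intro tendsto_intros tendsto_neg_powr filterlim_ident) auto
  then have "\<forall>\<^sub>F t in at_top. D * 2 powr b * t powr (b - c) < 1" by (intro order_tendstoD) auto
  then obtain T where T: "\<And>t. t \<ge> T \<Longrightarrow> D * 2 powr b * t powr (b - c) < 1"
    by (auto simp: eventually_at_top_linorder)
  define T' where "T' = max T (max 1 m)"
  show ?thesis
  proof (intro exI[of _ "D * (T' + m) powr b"] allI impI)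
    fix t :: real assume t: "t \<ge> 0"
    show "D * (t + m) powr b \<le> t powr c + D * (T' + m) powr b"
    proof (cases "t \<le> T'")
      case True
      then have "D * (t + m) powr b \<le> D * (T' + m) powr b"
        using assms t by (intro mult_left_mono powr_mono2) auto
      then show ?thesis by (simp add: add_increasing)
    next
      case False
      then have t1: "t > 0" "t \<ge> T" "m \<le> t" by (auto simp: T'_def)
      have "D * (t + m) powr b \<le> D * (2 * t) powr b" using assms t1 by (intro mult_left_mono powr_mono2) auto
      also have "\<dots> = D * 2 powr b * t powr (b - c) * t powr c"
        using t1 by (simp add: powr_mult powr_add[symmetric])
      also have "\<dots> \<le> 1 * t powr c" using T[OF t1(2)] by (intro mult_right_mono) auto
      also have "\<dots> \<le> t powr c + D * (T' + m) powr b" using assms by simp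
      finally show ?thesis .
    qed
  qed
qed

lemma exp_le_one_minus:
  fixes x :: real
  assumes "0 \<le> x" "x \<le> 1 / 2" shows "exp (- 2 * x) \<le> 1 - x"
proof -
  have "2 * x\<^sup>2 \<le> x" using assms mult_left_mono[of x "1/2" x] by (simp add: power2_eq_square)
  then have "- 2 * x \<le> ln (1 - x)" using ln_one_minus_pos_lower_bound[OF assms] by linarith
  then have "exp (- 2 * x) \<le> exp (ln (1 - x))" by simp
  then show ?thesis using assms by simp
qed

lemma return_profile_bound:
  fixes z :: "'a::finite" and b c :: real
  assumes d: "CARD('a) \<ge> 2" and b: "0 < b" "b < 1" "b < c"
    and contr: "CARD('a) * ((real CARD('a) - 1) / real CARD('a) ^ 2) powr b < 1"
    and \<mu>: "symmetric_generating_measure (mother_group z) \<mu>"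
  shows "seq_fun (return_profile (mother_group z) \<mu>) \<succcurlyeq> (\<lambda>t. ennreal (exp (- (t powr c))))"
proof -
  interpret M: group "mother_group z" by (rule group_mother_group)
  have supp: "set_pmf \<mu> \<subseteq> carrier (mother_group z)" "finite (set_pmf \<mu>)"
    and sym: "\<And>g. g \<in> carrier (mother_group z) \<Longrightarrow> pmf \<mu> (inv\<^bsub>mother_group z\<^esub> g) = pmf \<mu> g"
    using \<mu> by (auto simp: symmetric_generating_measure_def)
  obtain C where C: "C > 0" "\<And>n. n \<ge> 1 \<Longrightarrow> \<exists>V f. finite V \<and> V \<subseteq> carrier (mother_group z) \<and> V \<noteq> {} \<and>
      (\<forall>g. g \<notin> V \<longrightarrow> f g = 0) \<and> M.sqnorm f > 0 \<and> ln (card V) \<le> C * real n powr b \<and>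
      (\<forall>s\<in>mother_gens z. M.displacement f s \<le> C * real n powr (b - 1) * M.sqnorm f)"
    using test_functions[OF d b(1,2) contr, of z] by blast
  have "set_pmf \<mu> \<subseteq> generate (mother_group z) (mother_gens z)" using supp by (simp add: generate_mother_gens)
  from M.displacement_finite_set[OF mother_gens_carrier supp(2) this]
  obtain C' where C': "C' > 0" "\<And>f e x. M.fin_supp f \<Longrightarrow> \<forall>s\<in>mother_gens z. M.displacement f s \<le> e \<Longrightarrow> 0 \<le> e \<Longrightarrow>
      x \<in> set_pmf \<mu> \<Longrightarrow> M.displacement f x \<le> C' * e"
    by blast
  have "((\<lambda>n. C' * C / 2 * real n powr (b - 1)) \<longlongrightarrow> C' * C / 2 * 0) sequentially"
    using b by (intro tendsto_intros tendsto_neg_powr filterlim_real_sequentially) auto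
  then have "\<forall>\<^sub>F n in sequentially. C' * C / 2 * real n powr (b - 1) < 1 / 2" by (rule order_tendstoD(2)) simp
  then obtain n1 where n1: "\<And>n. n \<ge> n1 \<Longrightarrow> C' * C / 2 * real n powr (b - 1) < 1 / 2"
    by (auto simp: eventually_sequentially)
  \<comment> \<open>Time \<open>k\<close> is treated with the test function of scale
    \<open>k + n0\<close>; the shift ensures \<open>e \<le> 1 / 2\<close> and a positive scale also
    for small \<open>k\<close>.\<close>
  define n0 where "n0 = max n1 1"
  \<comment> \<open>The first summand pays for \<open>2 * k\<close> factors
    \<open>1 - e \<ge> exp (- 2 * e)\<close>, the second for \<open>ln (card V)\<close>.\<close>
  define D where "D = 2 * C' * C + C"
  have D: "D > 0" using C C' by (simp add: D_def add_pos_pos)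
  have bound: "exp (- (D * (real k + real n0) powr b)) \<le> pmf (conv_power (mother_group z) \<mu> (2 * k)) \<one>\<^bsub>mother_group z\<^esub>" for k
  proof -
    define n where "n = k + n0"
    define e where "e = C' * C / 2 * real n powr (b - 1)"
    have n: "n \<ge> 1" "n \<ge> n1" by (auto simp: n_def n0_def)
    have e: "0 \<le> e" "e \<le> 1 / 2" using n1[OF n(2)] C C' by (auto simp: e_def)
    obtain V f where V: "finite V" "V \<subseteq> carrier (mother_group z)" "V \<noteq> {}" "\<And>g. g \<notin> V \<Longrightarrow> f g = 0"
       and f: "M.sqnorm f > 0" "ln (card V) \<le> C * real n powr b"
         "\<forall>s\<in>mother_gens z. M.displacement f s \<le> C * real n powr (b - 1) * M.sqnorm f"
      using C(2)[OF n(1)] by blast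
    have fs: "M.fin_supp f" using V by (intro M.fin_suppI)
    have "M.displacement f h \<le> 2 * e * M.sqnorm f" if "h \<in> set_pmf \<mu>" for h
      using C'(2)[OF fs f(3) _ that] C f by (simp add: e_def mult_ac)
    then have "(1 - e) ^ (2 * k) / card V \<le> pmf (conv_power (mother_group z) \<mu> (2 * k)) \<one>\<^bsub>mother_group z\<^esub>"
      using V f e by (intro M.return_probability_ge[OF supp sym]) auto
    moreover have "exp (- (D * real n powr b)) \<le> (1 - e) ^ (2 * k) / card V"
    proof -
      have cV: "card V > 0" using V by (simp add: card_gt_0_iff)
      have "real k * real n powr (b - 1) \<le> real n * real n powr (b - 1)"
        by (intro mult_right_mono) (auto simp: n_def)
      also have "\<dots> = real n powr b" using n by (simp add: powr_mult_base)
      finally have "2 * C' * C * (real k * real n powr (b - 1)) \<le> 2 * C' * C * real n powr b"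
        using C C' by (intro mult_left_mono) auto
      then have "4 * real k * e \<le> 2 * C' * C * real n powr b" by (simp add: e_def mult_ac)
      then have "- (D * real n powr b) \<le> real (2 * k) * (- 2 * e) - ln (card V)"
        using f(2) by (simp add: D_def algebra_simps)
      then have "exp (- (D * real n powr b)) \<le> exp (real (2 * k) * (- 2 * e) - ln (card V))" by simp
      also have "\<dots> = exp (- 2 * e) ^ (2 * k) / card V"
        using cV by (simp only: exp_diff exp_of_nat_mult exp_ln of_nat_0_less_iff)
      also have "\<dots> \<le> (1 - e) ^ (2 * k) / card V"
        using exp_le_one_minus[OF e] by (intro divide_right_mono power_mono) auto
      finally show ?thesis .
    qed
    ultimately show ?thesis by (simp add: n_def)
  qed
  obtain K where K: "\<And>t. t \<ge> 0 \<Longrightarrow> D * (t + real n0) powr b \<le> t powr c + K"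
    using powr_shift_le[of D "real n0" b c] D b by auto
  show ?thesis unfolding fun_preceq_def
  proof (rule exI[of _ 1], rule exI[of _ "exp K"], intro conjI allI impI)
    fix t :: real assume t: "t \<ge> 0"
    define k where "k = nat \<lfloor>t\<rfloor>"
    have k: "real k \<le> t" using t by (simp add: k_def)
    have "D * (real k + real n0) powr b \<le> D * (t + real n0) powr b"
      using k D b by (intro mult_left_mono powr_mono2) auto
    then have "- (t powr c) \<le> K + - (D * (real k + real n0) powr b)" using K[OF t] by linarith
    then have "exp (- (t powr c)) \<le> exp (K + - (D * (real k + real n0) powr b))" by simp
    also have "\<dots> \<le> exp K * pmf (conv_power (mother_group z) \<mu> (2 * k)) \<one>\<^bsub>mother_group z\<^esub>"
      unfolding exp_add using bound[of k] by (intro mult_left_mono) auto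
    finally have "ennreal (exp (- (t powr c))) \<le>
        ennreal (exp K * pmf (conv_power (mother_group z) \<mu> (2 * k)) \<one>\<^bsub>mother_group z\<^esub>)"
      by (rule ennreal_leI)
    also have "\<dots> = ennreal (exp K) * ennreal (pmf (conv_power (mother_group z) \<mu> (2 * k)) \<one>\<^bsub>mother_group z\<^esub>)"
      by (rule ennreal_mult) auto
    finally show "ennreal (exp (- (t powr c))) \<le> ennreal (exp K) * seq_fun (return_profile (mother_group z) \<mu>) (1 * t)"
      by (simp add: seq_fun_def return_profile_def k_def)
  qed auto
qed

lemma isoperimetric_profile_bound:
  fixes z :: "'a::finite" and b c :: real
  assumes d: "CARD('a) \<ge> 2" and b: "0 < b" "b < 1" "2 * b / (1 - b) < c"
    and contr: "CARD('a) * ((real CARD('a) - 1) / real CARD('a) ^ 2) powr b < 1"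
    and S: "finite_generating_set (mother_group z) S"
  shows "seq_fun (cayley_isoperimetric_profile (mother_group z) S) \<preccurlyeq> (\<lambda>t. ennreal (exp (t powr c)))"
proof -
  interpret M: group "mother_group z" by (rule group_mother_group)
  have S': "finite S" "S \<subseteq> carrier (mother_group z)" using S by (auto simp: finite_generating_set_def)
  obtain C where C: "C > 0" "\<And>n. n \<ge> 1 \<Longrightarrow> \<exists>V f. finite V \<and> V \<subseteq> carrier (mother_group z) \<and> V \<noteq> {} \<and>
      (\<forall>g. g \<notin> V \<longrightarrow> f g = 0) \<and> M.sqnorm f > 0 \<and> ln (card V) \<le> C * real n powr b \<and>
      (\<forall>s\<in>mother_gens z. M.displacement f s \<le> C * real n powr (b - 1) * M.sqnorm f)"
    using test_functions[OF d b(1,2) contr, of z] by blast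
  have "S \<subseteq> generate (mother_group z) (mother_gens z)" using S' by (simp add: generate_mother_gens)
  from M.displacement_finite_set[OF mother_gens_carrier S'(1) this]
  obtain C' where C': "C' > 0" "\<And>f e x. M.fin_supp f \<Longrightarrow> \<forall>s\<in>mother_gens z. M.displacement f s \<le> e \<Longrightarrow> 0 \<le> e \<Longrightarrow>
      x \<in> S \<Longrightarrow> M.displacement f x \<le> C' * e"
    by blast
  \<comment> \<open>With this \<open>A\<close>, the bound
    \<open>A * (real k + 1)^2 \<le> real n powr (1 - b)\<close> gives the smallness condition of
    Cheeger's argument; the added 1 ensures \<open>A \<ge> 1\<close>.\<close>
  define A where "A = 16 * (real (card S))\<^sup>2 * (C' * C) + 1"
  have A: "A \<ge> 1" using C C' by (simp add: A_def)
  define D where "D = C * 2 powr b * A powr (b / (1 - b))"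
  define b' where "b' = 2 * b / (1 - b)"
  have b': "0 < b'" "b' < c" using b by (auto simp: b'_def)
  have D: "D > 0" using C A by (simp add: D_def)
  have bound: "cayley_isoperimetric_profile (mother_group z) S k \<le> ennreal (exp (D * (real k + 1) powr b'))" for k
  proof -
    \<comment> \<open>Solves \<open>x powr (1 - b) = A * (real k + 1)^2\<close>. Then
      \<open>x powr b\<close> is of order \<open>(real k + 1) powr (2 * b / (1 - b))\<close>, the
      source of the exponent.\<close>
    define x where "x = (A * (real k + 1)\<^sup>2) powr (1 / (1 - b))"
    define n where "n = nat \<lceil>x\<rceil>"
    have "A * (real k + 1)\<^sup>2 \<ge> 1 * 1" using A by (intro mult_mono) auto
    then have x1: "x \<ge> 1" unfolding x_def using b by (intro ge_one_powr_ge_zero) auto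
    have n: "n \<ge> 1" "x \<le> real n" "real n \<le> 2 * x" unfolding n_def using x1 by linarith+
    obtain V f where V: "finite V" "V \<subseteq> carrier (mother_group z)" "V \<noteq> {}" "\<And>g. g \<notin> V \<Longrightarrow> f g = 0"
       and f: "M.sqnorm f > 0" "ln (card V) \<le> C * real n powr b"
         "\<forall>s\<in>mother_gens z. M.displacement f s \<le> C * real n powr (b - 1) * M.sqnorm f"
      using C(2)[OF n(1)] by blast
    have fs: "M.fin_supp f" using V by (intro M.fin_suppI)
    define e where "e = C' * C * real n powr (b - 1)"
    have disp: "M.displacement f s \<le> e * M.sqnorm f" if "s \<in> S" for s
      using C'(2)[OF fs f(3) _ that] C f by (simp add: e_def mult_ac)
    have "A * (real k + 1)\<^sup>2 = x powr (1 - b)"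
      using A b by (simp add: x_def powr_powr)
    also have "\<dots> \<le> real n powr (1 - b)" using n x1 b by (intro powr_mono2) auto
    finally have nA: "A * (real k + 1)\<^sup>2 \<le> real n powr (1 - b)" .
    have "(4 * real k * real (card S))\<^sup>2 * (C' * C) \<le> (A - 1) * (real k)\<^sup>2"
      by (simp add: A_def power_mult_distrib algebra_simps)
    also have "\<dots> < A * (real k + 1)\<^sup>2"
    proof -
      have "(A - 1) * (real k)\<^sup>2 \<le> A * (real k)\<^sup>2" by (intro mult_right_mono) auto
      also have "\<dots> < A * (real k + 1)\<^sup>2" using A by (intro mult_strict_left_mono power_strict_mono) auto
      finally show ?thesis .
    qed
    also note nA
    finally have "(4 * real k * real (card S))\<^sup>2 * (C' * C) * real n powr (b - 1) <
        real n powr (1 - b) * real n powr (b - 1)"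
      using n(1) by (intro mult_strict_right_mono) auto
    also have "\<dots> = 1" using n(1) by (simp add: powr_add[symmetric])
    finally have "(4 * real k * real (card S))\<^sup>2 * e < 1" by (simp add: e_def mult_ac)
    then have "sqrt ((4 * real k * real (card S))\<^sup>2 * e) < 1" by simp
    then have "4 * real k * real (card S) * sqrt e < 1" by (simp add: real_sqrt_mult)
    then have "cayley_isoperimetric_profile (mother_group z) S k \<le> of_nat (card V)"
      using V f(1) S' disp by (intro M.isoperimetric_profile_le[of V f S e]) auto
    also have "\<dots> = ennreal (real (card V))" by (simp add: ennreal_of_nat_eq_real_of_nat)
    also have "\<dots> \<le> ennreal (exp (D * (real k + 1) powr b'))"
    proof (rule ennreal_leI)
      have cV: "card V > 0" using V by (simp add: card_gt_0_iff)
      have "ln (card V) \<le> C * (2 * x) powr b"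
        using f(2) n x1 b C by (intro order_trans[OF f(2)] mult_left_mono powr_mono2) auto
      also have "\<dots> = C * 2 powr b * (A * (real k + 1)\<^sup>2) powr (b / (1 - b))"
        using x1 by (simp add: powr_mult x_def powr_powr)
      also have "(A * (real k + 1)\<^sup>2) powr (b / (1 - b)) = A powr (b / (1 - b)) * (real k + 1) powr b'"
      proof -
        have "(real k + 1)\<^sup>2 = (real k + 1) powr 2" by simp
        then have "((real k + 1)\<^sup>2) powr (b / (1 - b)) = (real k + 1) powr b'"
          by (simp only: powr_powr b'_def) simp
        then show ?thesis using A by (simp add: powr_mult)
      qed
      finally have "ln (card V) \<le> D * (real k + 1) powr b'" by (simp add: D_def mult_ac)
      then have "exp (ln (card V)) \<le> exp (D * (real k + 1) powr b')" by simp
      then show "real (card V) \<le> exp (D * (real k + 1) powr b')" using cV by simp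
    qed
    finally show ?thesis .
  qed
  obtain K where K: "\<And>t. t \<ge> 0 \<Longrightarrow> D * (t + 1) powr b' \<le> t powr c + K"
    using powr_shift_le[of D 1 b' c] D b' by auto
  show ?thesis unfolding fun_preceq_def
  proof (rule exI[of _ 1], rule exI[of _ "exp K"], intro conjI allI impI)
    fix t :: real assume t: "t \<ge> 0"
    define k where "k = nat \<lfloor>t\<rfloor>"
    have k: "real k \<le> t" using t by (simp add: k_def)
    have "D * (real k + 1) powr b' \<le> D * (t + 1) powr b'"
      using k D b' by (intro mult_left_mono powr_mono2) auto
    then have "exp (D * (real k + 1) powr b') \<le> exp (K + t powr c)" using K[OF t] by simp
    then have "ennreal (exp (D * (real k + 1) powr b')) \<le> ennreal (exp K * exp (t powr c))"
      unfolding exp_add by (rule ennreal_leI)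
    also have "\<dots> = ennreal (exp K) * ennreal (exp (t powr c))" by (rule ennreal_mult) auto
    finally show "seq_fun (cayley_isoperimetric_profile (mother_group z) S) t \<le> ennreal (exp K) * ennreal (exp ((1 * t) powr c))"
      using order_trans[OF bound[of k]] by (simp add: seq_fun_def k_def)
  qed auto
qed

theorem theorem4p13:
  fixes z :: "'a::finite" and d :: nat and \<alpha> :: real
  assumes "CARD('a) = d" and "d \<ge> 2"
    and "\<alpha> = ln (real d) / ln ((real d)\<^sup>2 / (real d - 1))"
  shows "\<alpha> < 1 \<and>
    (\<forall>\<epsilon>>0.
      (\<forall>\<mu>. symmetric_generating_measure (mother_group z) \<mu> \<longrightarrow>
         seq_fun (return_profile (mother_group z) \<mu>)
           \<succcurlyeq> (\<lambda>t. ennreal (exp (- (t powr (\<alpha> + \<epsilon>)))))) \<and>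
      (\<forall>S. finite_generating_set (mother_group z) S \<longrightarrow>
         seq_fun (cayley_isoperimetric_profile (mother_group z) S)
           \<preccurlyeq> (\<lambda>t. ennreal (exp (t powr (2 * \<alpha> / (1 - \<alpha>) + \<epsilon>))))))"
proof -
  define L where "L = ln ((real d)\<^sup>2 / (real d - 1))"
  have d: "real d \<ge> 2" using assms(2) by simp
  have "real d < (real d)\<^sup>2 / (real d - 1)" using d by (simp add: field_simps power2_eq_square)
  then have lt: "ln (real d) < L" unfolding L_def using d by (subst ln_less_cancel_iff) auto
  have ln_d: "ln (real d) > 0" using d by simp
  have L: "L > 0" using lt ln_d by simp
  have \<alpha>L: "\<alpha> * L = ln (real d)" using L assms(3) by (simp add: L_def)
  have \<alpha>1: "\<alpha> < 1" and \<alpha>0: "\<alpha> > 0" using lt ln_d L assms(3) by (auto simp: L_def[symmetric])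
  \<comment> \<open>As \<open>(d - 1) / d^2 = exp (- L)\<close> and
    \<open>d = exp (\<alpha> * L)\<close>, the product is \<open>exp ((\<alpha> - b) * L)\<close>;
    \<open>\<alpha>\<close> is the exponent at which the contraction factor equals 1.\<close>
  have contr: "CARD('a) * ((real CARD('a) - 1) / real CARD('a) ^ 2) powr b < 1" if "\<alpha> < b" for b
  proof -
    have q: "(real d - 1) / (real d)\<^sup>2 > 0" using d by simp
    have "ln ((real d - 1) / (real d)\<^sup>2) = - L" using d by (simp add: L_def ln_div)
    then have "((real d - 1) / (real d)\<^sup>2) powr b = exp (- (b * L))" using q d by (simp add: powr_def)
    moreover have "real d = exp (\<alpha> * L)" using d by (simp add: \<alpha>L)
    ultimately have "real d * ((real d - 1) / (real d)\<^sup>2) powr b = exp (\<alpha> * L - b * L)"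
      by (metis exp_add diff_conv_add_uminus)
    also have "\<dots> < 1" using that L by simp
    finally show ?thesis using assms(1) by simp
  qed
  \<comment> \<open>Any \<open>b\<close> slightly above \<open>\<alpha>\<close> works, since
    \<open>2 * b / (1 - b)\<close> is continuous at \<open>\<alpha>\<close>; \<open>b < 1\<close> is
    demanded separately because \<open>\<epsilon>\<close> may be large.\<close>
  have "\<exists>b. 0 < b \<and> b < 1 \<and> \<alpha> < b \<and> b < \<alpha> + \<epsilon> \<and> 2 * b / (1 - b) < 2 * \<alpha> / (1 - \<alpha>) + \<epsilon>"
    if \<epsilon>: "\<epsilon> > 0" for \<epsilon>
  proof -
    have id: "((\<lambda>b. b) \<longlongrightarrow> \<alpha>) (at_right \<alpha>)" by (rule tendsto_ident_at)
    have "((\<lambda>b. 2 * b / (1 - b)) \<longlongrightarrow> 2 * \<alpha> / (1 - \<alpha>)) (at_right \<alpha>)"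
      using \<alpha>1 by (intro tendsto_intros id) auto
    then have 1: "\<forall>\<^sub>F b in at_right \<alpha>. 2 * b / (1 - b) < 2 * \<alpha> / (1 - \<alpha>) + \<epsilon>"
      using \<epsilon> by (intro order_tendstoD(2)[where y = "2 * \<alpha> / (1 - \<alpha>)"]) auto
    have 2: "\<forall>\<^sub>F b in at_right \<alpha>. b < min 1 (\<alpha> + \<epsilon>)"
      using order_tendstoD(2)[OF id, of "min 1 (\<alpha> + \<epsilon>)"] \<alpha>1 \<epsilon> by simp
    have 3: "\<forall>\<^sub>F b in at_right \<alpha>. \<alpha> < b" by (simp add: eventually_at_right_less)
    from 1 2 3 have "\<forall>\<^sub>F b in at_right \<alpha>. 0 < b \<and> b < 1 \<and> \<alpha> < b \<and> b < \<alpha> + \<epsilon> \<and> 2 * b / (1 - b) < 2 * \<alpha> / (1 - \<alpha>) + \<epsilon>"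
      by eventually_elim (use \<alpha>0 in auto)
    then show ?thesis by (rule eventually_happens'[OF trivial_limit_at_right_real])
  qed
  then show ?thesis
    using \<alpha>1 assms(1,2) contr return_profile_bound[where z = z] isoperimetric_profile_bound[where z = z]
    by metis
qed

end
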